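(* Let $q$ be a power of a prime $p$ and $K$ an algebraic closure of $\mathbb{F}_q$. The DGZ curve is the only irreducible plane curve over $K$ of degree $d<q^3-q$ which is $\mathrm{PGL}(3,q)$-invariant.
   Context: $\mathrm{PGL}(3,q)$ acts on $\mathrm{PG}(2,K)$; a curve is invariant if every element maps it onto itself. The DGZ curve is the plane curve with affine equation $$\frac{(X^{q^3}-X)(Y^{q}-Y)-(Y^{q^3}-Y)(X^{q}-X)}{(X^{q^2}-X)(Y^q-Y)-(Y^{q^2}-Y)(X^q-X)}=0,$$ where the quotient is an exact polynomial of degree $q^3-q^2$. *)

theory Defs
  imports "HOL-Analysis.Analysis" "HOL-Library.Poly_Mapping" "HOL-Library.Product_Plus"
    "HOL-Computational_Algebra.Polynomial" "HOL-Computational_Algebra.Factorial_Ring"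
begin

text \<open>Polynomials in the three homogeneous coordinates X, Y, Z over a field 'a.
  A monomial X^a Y^b Z^c is encoded by its exponent triple (a,b,c).\<close>
type_synonym 'a tpoly = "(nat \<times> nat \<times> nat) \<Rightarrow>\<^sub>0 'a"

definition tconst :: "'a::comm_ring_1 \<Rightarrow> 'a tpoly" where
  "tconst c = Poly_Mapping.single (0,0,0) c"

definition varX :: "'a::comm_ring_1 tpoly" where "varX = Poly_Mapping.single (1,0,0) 1"
definition varY :: "'a::comm_ring_1 tpoly" where "varY = Poly_Mapping.single (0,1,0) 1"
definition varZ :: "'a::comm_ring_1 tpoly" where "varZ = Poly_Mapping.single (0,0,1) 1"

definition mdeg :: "nat \<times> nat \<times> nat \<Rightarrow> nat" where
  "mdeg m = fst m + fst (snd m) + snd (snd m)"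

text \<open>F is a nonzero form (homogeneous polynomial) of degree d, i.e. it defines a plane curve
  of degree d in PG(2,K).\<close>
definition form_of_degree :: "'a::comm_ring_1 tpoly \<Rightarrow> nat \<Rightarrow> bool" where
  "form_of_degree F d \<longleftrightarrow> F \<noteq> 0 \<and> (\<forall>m\<in>Poly_Mapping.keys F. mdeg m = d)"

definition tsubst :: "'a::comm_ring_1 tpoly \<Rightarrow> 'a tpoly \<Rightarrow> 'a tpoly \<Rightarrow> 'a tpoly \<Rightarrow> 'a tpoly" where
  "tsubst F u v w = (\<Sum>m\<in>Poly_Mapping.keys F.
      tconst (Poly_Mapping.lookup F m) * u ^ fst m * v ^ fst (snd m) * w ^ snd (snd m))"

definition lin_form :: "'a::comm_ring_1^3^3 \<Rightarrow> 3 \<Rightarrow> 'a tpoly" where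
  "lin_form A i = tconst (A$i$1) * varX + tconst (A$i$2) * varY + tconst (A$i$3) * varZ"

definition transform :: "'a::comm_ring_1 tpoly \<Rightarrow> 'a^3^3 \<Rightarrow> 'a tpoly" where
  "transform F A = tsubst F (lin_form A 1) (lin_form A 2) (lin_form A 3)"

text \<open>Matrices representing elements of PGL(3,q): invertible, entries in F_q = {x. x^q = x}.\<close>
definition GL3q :: "nat \<Rightarrow> ('a::field^3^3) set" where
  "GL3q q = {A. det A \<noteq> 0 \<and> (\<forall>i j. (A$i$j) ^ q = A$i$j)}"

text \<open>The curve F = 0 is PGL(3,q)-invariant: every element maps it onto itself, i.e.
  the transformed form is a nonzero scalar multiple of F.\<close>
definition PGL3q_invariant :: "nat \<Rightarrow> 'a::field tpoly \<Rightarrow> bool" where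
  "PGL3q_invariant q F \<longleftrightarrow> (\<forall>A\<in>GL3q q. \<exists>c. c \<noteq> 0 \<and> transform F A = tconst c * F)"

text \<open>Homogeneous Moore-type determinant
  det [[X,Y,Z],[X^e,Y^e,Z^e],[X^q,Y^q,Z^q]]; with Z = 1 and e = q^3 (resp. q^2) it is the
  numerator (resp. denominator) of the affine DGZ equation.\<close>
definition moore :: "nat \<Rightarrow> nat \<Rightarrow> 'a::comm_ring_1 tpoly" where
  "moore q e =
     varX * (varY ^ e * varZ ^ q - varZ ^ e * varY ^ q)
   - varY * (varX ^ e * varZ ^ q - varZ ^ e * varX ^ q)
   + varZ * (varX ^ e * varY ^ q - varY ^ e * varX ^ q)"

text \<open>F defines the DGZ curve: F is (a nonzero scalar multiple of) the exact quotient
  moore q (q^3) / moore q (q^2).\<close>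
definition is_DGZ :: "nat \<Rightarrow> 'a::field tpoly \<Rightarrow> bool" where
  "is_DGZ q F \<longleftrightarrow> (\<exists>c. c \<noteq> 0 \<and> tconst c * F * moore q (q^2) = moore q (q^3))"

definition alg_closed :: "'a::field itself \<Rightarrow> bool" where
  "alg_closed _ \<longleftrightarrow> (\<forall>P::'a poly. degree P > 0 \<longrightarrow> (\<exists>x. poly P x = 0))"

definition algebraic_over_prime_field :: "'a::field itself \<Rightarrow> bool" where
  "algebraic_over_prime_field _ \<longleftrightarrow>
     (\<forall>x::'a. \<exists>P::'a poly. P \<noteq> 0 \<and> (\<forall>i. coeff P i \<in> range of_nat) \<and> poly P x = 0)"

end

theory Submission
  imports "Berlekamp_Zassenhaus.Unique_Factorization_Poly" Defs
begin

text \<open>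
  Call a form invariant if it is fixed by all perspectivities over \<open>GF(q)\<close> whose axis is one of the
  three coordinate lines. An irreducible \<open>PGL(3,q)\<close>-invariant form does not vanish on such an axis,
  where the perspectivity is the identity, so it is invariant in this sense.

  Let \<open>F\<close> be invariant of degree \<open>d < q^3 - q\<close>. The translations \<open>X \<mapsto> X + aZ\<close> show that
  \<open>F(x,1,0)\<close> is a polynomial in \<open>x^q\<close>; the maps \<open>x \<mapsto> x + a\<close> and \<open>x \<mapsto> cx\<close> then leave only
  \<open>\<alpha> + \<beta> (x^(q^2) - x^q)^(q-1)\<close>. Comparing with \<open>F(1,y,0)\<close> gives that either \<open>Z\<close> divides \<open>F\<close>, or
  \<open>F(1,0,0) \<noteq> 0\<close> and \<open>d\<close> is \<open>0\<close> or \<open>q^3 - q^2\<close>. In degree \<open>q^3 - q^2\<close> the first case cannot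
  occur: \<open>F\<close> would be divisible by the \<open>(q-1)\<close>-st power of every line \<open>Z = aX + bY\<close>, while its
  \<open>Z\<close>-degree is smaller than \<open>q^2 (q-1)\<close>. Hence invariant forms of degree \<open>q^3 - q^2\<close> are unique up
  to scalars, and \<open>d = q^3 - q^2\<close> for irreducible \<open>F\<close>.

  The DGZ form is the Dickson invariant \<open>c^q + V^(q-1)\<close>, where \<open>c\<close> is the Dickson invariant of degree
  \<open>q^2 - q\<close> in \<open>X, Y\<close> and \<open>V\<close> is, as a polynomial in \<open>Z\<close>, the product of all \<open>Z - aX - bY\<close>. At each
  of its points on a \<open>GF(q)\<close>-line it is unibranch, so only one irreducible factor passes through the
  point. Such a factor is therefore fixed by the perspectivities with that line as axis, so it is
  invariant, and by the degree result above it is the whole DGZ form.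
\<close>

hide_const (open) Coset.order
no_notation Matrix.vec_index (infixl "$" 100)

section \<open>Evaluation of ternary polynomials\<close>

definition tmono :: "nat \<times> nat \<times> nat \<Rightarrow> 'b::comm_ring_1 \<Rightarrow> 'b \<Rightarrow> 'b \<Rightarrow> 'b" where
  "tmono m x y z = x ^ fst m * y ^ fst (snd m) * z ^ snd (snd m)"

text \<open>The coefficient map \<open>h\<close> is a parameter so that one evaluation serves
  everywhere: the identity gives values at points, \<open>tconst\<close> gives substitution into
  forms, and the constant embeddings \<open>const1\<close>, \<open>const2\<close>,
  \<open>const3\<close> give restrictions with polynomial parameters.\<close>

definition teval :: "('a::comm_ring_1 \<Rightarrow> 'b::comm_ring_1) \<Rightarrow> 'a tpoly \<Rightarrow> 'b \<Rightarrow> 'b \<Rightarrow> 'b \<Rightarrow> 'b" where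
  "teval h F x y z = (\<Sum>m\<in>Poly_Mapping.keys F. h (Poly_Mapping.lookup F m) * tmono m x y z)"

lemma tmono_0 [simp]: "tmono 0 x y z = 1"
  by (simp add: tmono_def zero_prod_def)

lemma tmono_add: "tmono (m + n) x y z = tmono m x y z * tmono n x y z"
  by (simp add: tmono_def power_add mult_ac)

lemma (in comm_ring_hom) hom_tmono: "hom (tmono m x y z) = tmono m (hom x) (hom y) (hom z)"
  by (simp add: tmono_def hom_mult hom_power)

lemma tpoly_sum_single: "F = (\<Sum>m\<in>Poly_Mapping.keys F. Poly_Mapping.single m (Poly_Mapping.lookup F m))"
  by (intro poly_mapping_eqI)
     (simp add: lookup_sum lookup_single when_def in_keys_iff)

context
  fixes h :: "'a::comm_ring_1 \<Rightarrow> 'b::comm_ring_1"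
  assumes h: "comm_ring_hom h"
begin

interpretation h: comm_ring_hom h by (rule h)

lemma teval_superset:
  assumes "finite A" "Poly_Mapping.keys F \<subseteq> A"
  shows "teval h F x y z = (\<Sum>m\<in>A. h (Poly_Mapping.lookup F m) * tmono m x y z)"
  unfolding teval_def using assms
  by (intro sum.mono_neutral_left) (auto simp: in_keys_iff)

lemma teval_single: "teval h (Poly_Mapping.single m c) x y z = h c * tmono m x y z"
  by (subst teval_superset[of "{m}"]) (auto simp: lookup_single)

lemma teval_0: "teval h 0 x y z = 0"
  by (simp add: teval_def)

lemma teval_add: "teval h (F + G) x y z = teval h F x y z + teval h G x y z"
proof -
  let ?A = "Poly_Mapping.keys F \<union> Poly_Mapping.keys G"
  have "Poly_Mapping.keys (F + G) \<subseteq> ?A" by (rule Poly_Mapping.keys_add)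
  then show ?thesis
    by (simp add: teval_superset[of ?A] lookup_add h.hom_add algebra_simps sum.distrib)
qed

lemma teval_sum: "teval h (\<Sum>i\<in>A. f i) x y z = (\<Sum>i\<in>A. teval h (f i) x y z)"
  by (induction A rule: infinite_finite_induct) (simp_all add: teval_0 teval_add)

lemma teval_mult: "teval h (F * G) x y z = teval h F x y z * teval h G x y z"
proof -
  let ?s = "\<lambda>F m. Poly_Mapping.single m (Poly_Mapping.lookup F m)"
  have "F * G = (\<Sum>m\<in>Poly_Mapping.keys F. \<Sum>n\<in>Poly_Mapping.keys G. ?s F m * ?s G n)"
    unfolding sum_product[symmetric] by (simp flip: tpoly_sum_single)
  then have "teval h (F * G) x y z = (\<Sum>m\<in>Poly_Mapping.keys F. \<Sum>n\<in>Poly_Mapping.keys G.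
      (h (Poly_Mapping.lookup F m) * tmono m x y z) * (h (Poly_Mapping.lookup G n) * tmono n x y z))"
    by (simp add: teval_sum mult_single teval_single tmono_add h.hom_mult mult_ac)
  also have "\<dots> = teval h F x y z * teval h G x y z"
    by (simp add: teval_def sum_product)
  finally show ?thesis .
qed

lemma teval_tconst: "teval h (tconst c) x y z = h c"
  by (simp add: tconst_def teval_single tmono_def)

lemma teval_1: "teval h 1 x y z = 1"
  by (metis h.hom_one mult_1 single_one teval_single tmono_0)

lemma teval_hom: "comm_ring_hom (\<lambda>F. teval h F x y z)"
  by unfold_locales (simp_all add: teval_0 teval_1 teval_add teval_mult)

lemma teval_var:
  "teval h varX x y z = x" "teval h varY x y z = y" "teval h varZ x y z = z"
  by (simp_all add: varX_def varY_def varZ_def teval_single tmono_def)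

lemma teval_diff: "teval h (F - G) x y z = teval h F x y z - teval h G x y z"
proof -
  interpret t: comm_ring_hom "\<lambda>F. teval h F x y z" by (rule teval_hom)
  show ?thesis by (rule t.hom_minus)
qed

lemma teval_uminus: "teval h (- F) x y z = - teval h F x y z"
proof -
  interpret t: comm_ring_hom "\<lambda>F. teval h F x y z" by (rule teval_hom)
  show ?thesis by (rule t.hom_uminus)
qed

lemma teval_power: "teval h (F ^ n) x y z = teval h F x y z ^ n"
  by (induction n) (simp_all add: teval_1 teval_mult)

lemmas teval_simps = teval_0 teval_1 teval_add teval_mult teval_tconst teval_var teval_diff
  teval_uminus teval_power

text \<open>Lets every specialization be read as another evaluation: \<open>g\<close> will be
  evaluation at a point, composition of polynomials or a map on coefficients.\<close>

lemma hom_teval: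
  assumes "comm_ring_hom g"
  shows "g (teval h F x y z) = teval (\<lambda>c. g (h c)) F (g x) (g y) (g z)"
proof -
  interpret g: comm_ring_hom g by (rule assms)
  show ?thesis by (simp add: teval_def g.hom_sum g.hom_mult g.hom_tmono)
qed

lemma teval_form:
  assumes "\<forall>m\<in>Poly_Mapping.keys F. mdeg m = d"
  shows "teval h F (t * x) (t * y) (t * z) = t ^ d * teval h F x y z"
proof -
  have "tmono m (t * x) (t * y) (t * z) = t ^ d * tmono m x y z" if "m \<in> Poly_Mapping.keys F" for m
    using assms that by (auto simp: tmono_def mdeg_def power_add power_mult_distrib mult_ac)
  then show ?thesis
    by (simp add: teval_def sum_distrib_left mult_ac)
qed

end

lemma tconst_hom: "comm_ring_hom tconst"
  by unfold_locales
     (auto simp: tconst_def single_add mult_single simp flip: zero_prod_def)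

lemma tconst_mult: "tconst (a * b) = tconst a * tconst b"
  by (simp add: tconst_def mult_single)

lemma tconst_0: "tconst 0 = 0"
  by (simp add: tconst_def)

lemma tconst_1: "tconst 1 = 1"
  by (simp add: tconst_def flip: zero_prod_def)

lemma tconst_eq_0_iff: "tconst c = 0 \<longleftrightarrow> c = 0"
  by (metis lookup_single_eq lookup_zero single_zero tconst_def)

lemma tconst_power: "tconst (a ^ n) = tconst a ^ n"
  by (induction n) (simp_all add: tconst_mult tconst_1)

lemma comm_ring_hom_id: "comm_ring_hom (\<lambda>x. x)"
  by unfold_locales auto

lemma comm_ring_hom_comp: "comm_ring_hom g \<Longrightarrow> comm_ring_hom h \<Longrightarrow> comm_ring_hom (\<lambda>x. g (h x))"
proof -
  assume "comm_ring_hom g" "comm_ring_hom h"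
  then interpret g: comm_ring_hom g + h: comm_ring_hom h .
  show ?thesis by unfold_locales (auto simp: g.hom_add g.hom_mult h.hom_add h.hom_mult)
qed

lemma tsubst_eq_teval: "tsubst F u v w = teval tconst F u v w"
  by (simp add: tsubst_def teval_def tmono_def mult_ac)

lemma tconst_tmono: "tconst c * tmono m varX varY varZ = Poly_Mapping.single m c"
proof -
  have X: "varX ^ n = Poly_Mapping.single (n, 0, 0) (1::'a)" for n
    by (induction n) (simp_all add: varX_def mult_single flip: zero_prod_def single_one)
  have Y: "varY ^ n = Poly_Mapping.single (0, n, 0) (1::'a)" for n
    by (induction n) (simp_all add: varY_def mult_single flip: zero_prod_def single_one)
  have Z: "varZ ^ n = Poly_Mapping.single (0, 0, n) (1::'a)" for n
    by (induction n) (simp_all add: varZ_def mult_single flip: zero_prod_def single_one)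
  show ?thesis
    by (simp add: tmono_def X Y Z tconst_def mult_single flip: zero_prod_def)
qed

lemma teval_self: "teval tconst F varX varY varZ = F"
  unfolding teval_def tconst_tmono by (rule tpoly_sum_single[symmetric])

lemma teval_tsubst:
  assumes "comm_ring_hom h"
  shows "teval h (tsubst F u v w) x y z = teval h F (teval h u x y z) (teval h v x y z) (teval h w x y z)"
  unfolding tsubst_eq_teval
  by (simp add: hom_teval[OF tconst_hom teval_hom[OF assms]] teval_tconst[OF assms])

section \<open>Nested univariate polynomials\<close>

abbreviation (input) const1 :: "'a::comm_ring_1 \<Rightarrow> 'a poly" where "const1 c \<equiv> [:c:]"
abbreviation (input) const2 :: "'a::comm_ring_1 \<Rightarrow> 'a poly poly" where "const2 c \<equiv> [:[:c:]:]"
abbreviation (input) const3 :: "'a::comm_ring_1 \<Rightarrow> 'a poly poly poly" where "const3 c \<equiv> [:[:[:c:]:]:]"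

lemma const1_hom: "comm_ring_hom const1" by unfold_locales auto
lemma const2_hom: "comm_ring_hom const2" by unfold_locales auto
lemma const3_hom: "comm_ring_hom const3" by unfold_locales auto

text \<open>Z becomes the outermost variable and X the innermost, so degree, root order and
  \<open>pcompose\<close> of the result refer to Z. The iterated ring also supplies the absence of
  zero divisors and unique factorization.\<close>

definition nested :: "'a::comm_ring_1 tpoly \<Rightarrow> 'a poly poly poly" where
  "nested F = teval const3 F [:[:[:0, 1:]:]:] [:[:0, 1:]:] [:0, 1:]"

lemma const_power: "[:c::'a::comm_ring_1:] ^ n = [:c ^ n:]"
  by (induction n) auto

lemma X_power: "[:0, 1::'a::comm_ring_1:] ^ n = monom 1 n"
  by (simp add: monom_altdef)

lemma pCons_0_1_power: "pCons 0 (1::'a::comm_ring_1 poly) ^ n = monom 1 n"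
  by (simp add: monom_altdef)

lemma coeff_nested_monomial:
  "coeff (coeff (coeff (const3 k * tmono m [:[:[:0, 1:]:]:] [:[:0, 1:]:] [:0, 1:]) c) b) a =
     (k when m = (a, b, c))" for k :: "'a::comm_ring_1"
proof -
  have "const3 k * tmono (i, j, l) [:[:[:0, 1:]:]:] [:[:0, 1:]:] [:0, 1:] =
      monom (monom (monom k i) j) l" for i j l
  proof -
    have "[:[:[:0, 1:]:]:] ^ i = [:[:monom (1::'a) i:]:]"
      by (simp only: const_power X_power)
    moreover have "[:[:0, 1:]:] ^ j = [:monom (1::'a poly) j:]"
      by (simp only: const_power X_power)
    moreover have "[:0, 1:] ^ l = monom (1::'a poly poly) l"
      by (simp only: X_power)
    ultimately show ?thesis
      by (simp add: tmono_def smult_monom)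
  qed
  then show ?thesis
    by (cases m) (simp add: when_def)
qed

lemma coeff_nested: "coeff (coeff (coeff (nested F) c) b) a = Poly_Mapping.lookup F (a, b, c)"
proof -
  have "coeff (coeff (coeff (nested F) c) b) a =
     (\<Sum>m\<in>Poly_Mapping.keys F. (Poly_Mapping.lookup F m when m = (a, b, c)))"
    unfolding nested_def teval_def by (simp only: coeff_sum coeff_nested_monomial)
  also have "\<dots> = Poly_Mapping.lookup F (a, b, c)"
    by (auto simp: when_def in_keys_iff)
  finally show ?thesis .
qed

lemma nested_inj: "nested F = nested G \<Longrightarrow> F = G"
  by (intro poly_mapping_eqI) (metis coeff_nested prod.exhaust)

lemma nested_eq_iff: "nested F = nested G \<longleftrightarrow> F = G"
  by (auto dest: nested_inj)

lemma nested_eq_0_iff: "nested F = 0 \<longleftrightarrow> F = 0"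
  using nested_inj[of F 0] by (auto simp: nested_def teval_0[OF const3_hom])

lemma nested_mult: "nested (F * G) = nested F * nested G"
  by (simp add: nested_def teval_mult[OF const3_hom])

lemma nested_add: "nested (F + G) = nested F + nested G"
  by (simp add: nested_def teval_add[OF const3_hom])

lemma nested_0: "nested 0 = 0"
  by (simp add: nested_def teval_0[OF const3_hom])

text \<open>Allows factors found in the nested ring to be pulled back to ternary
  polynomials.\<close>

lemma nested_surj: "\<exists>F. nested F = P"
proof -
  have X: "nested varX = [:[:[:0, 1:]:]:]" "nested varY = [:[:0, 1:]:]" "nested varZ = [:0, 1:]"
    "nested (tconst c) = const3 c" for c
    unfolding nested_def teval_var[OF const3_hom] teval_tconst[OF const3_hom] by (rule refl)+
  have 1: "\<exists>F. nested F = [:[:p:]:]" for p :: "'a poly"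
  proof (induction p)
    case 0 then show ?case by (intro exI[of _ 0]) (simp add: nested_0)
  next
    case (pCons c p)
    then obtain F where "nested F = [:[:p:]:]" by blast
    then have "nested (tconst c + varX * F) = [:[:pCons c p:]:]"
      by (simp add: nested_add nested_mult X)
    then show ?case ..
  qed
  have 2: "\<exists>F. nested F = [:p:]" for p :: "'a poly poly"
  proof (induction p)
    case 0 then show ?case by (intro exI[of _ 0]) (simp add: nested_0)
  next
    case (pCons c p)
    then obtain F G where "nested F = [:p:]" "nested G = [:[:c:]:]" using 1 by blast
    then have "nested (G + varY * F) = [:pCons c p:]"
      by (simp add: nested_add nested_mult X)
    then show ?case ..
  qed
  show ?thesis
  proof (induction P)
    case 0 then show ?case by (intro exI[of _ 0]) (simp add: nested_0)
  next
    case (pCons c p)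
    then obtain F G where "nested F = p" "nested G = [:c:]" using 2 by blast
    then have "nested (G + varZ * F) = pCons c p"
      by (simp add: nested_add nested_mult X)
    then show ?case ..
  qed
qed

lemma nested_1: "nested 1 = 1"
  by (simp add: nested_def teval_1[OF const3_hom])

lemma tpoly_mult_eq_0: "(F::'a::field tpoly) * G = 0 \<longleftrightarrow> F = 0 \<or> G = 0"
  using nested_eq_0_iff[of "F * G"] nested_eq_0_iff[of F] nested_eq_0_iff[of G]
  by (simp add: nested_mult)

lemma tpoly_mult_cancel:
  assumes "(F::'a::field tpoly) * H = G * H" "H \<noteq> 0"
  shows "F = G"
proof -
  have "(F - G) * H = 0" using assms(1) by (simp add: algebra_simps)
  then show ?thesis using assms(2) by (simp add: tpoly_mult_eq_0)
qed

lemma nested_dvd_iff: "nested F dvd nested G \<longleftrightarrow> F dvd G"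
proof
  assume "nested F dvd nested G"
  then obtain K where K: "nested G = nested F * K" by (rule dvdE)
  obtain H where "nested H = K" using nested_surj by blast
  then have "nested G = nested (F * H)" using K by (simp add: nested_mult)
  then have "G = F * H" by (rule nested_inj)
  then show "F dvd G" by simp
next
  assume "F dvd G"
  then obtain H where "G = F * H" by (rule dvdE)
  then show "nested F dvd nested G" by (simp add: nested_mult)
qed

lemma irreducible_nested: "irreducible (nested F) \<longleftrightarrow> irreducible F"
proof -
  have u: "nested F dvd 1 \<longleftrightarrow> F dvd 1" for F :: "'a tpoly"
    using nested_dvd_iff[of F 1] by (simp add: nested_1)
  have "(\<forall>a b. nested F = a * b \<longrightarrow> a dvd 1 \<or> b dvd 1) \<longleftrightarrow>
      (\<forall>A B. nested F = nested A * nested B \<longrightarrow> nested A dvd 1 \<or> nested B dvd 1)"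
  proof (intro iffI allI impI)
    fix a b assume *: "\<forall>A B. nested F = nested A * nested B \<longrightarrow> nested A dvd 1 \<or> nested B dvd 1"
      and "nested F = a * b"
    obtain A B where "nested A = a" "nested B = b" using nested_surj by blast
    with * \<open>nested F = a * b\<close> show "a dvd 1 \<or> b dvd 1" by blast
  qed simp
  also have "\<dots> \<longleftrightarrow> (\<forall>a b. F = a * b \<longrightarrow> a dvd 1 \<or> b dvd 1)"
    unfolding u nested_mult[symmetric] nested_eq_iff ..
  finally show ?thesis unfolding irreducible_def by (simp add: u nested_eq_0_iff)
qed

text \<open>By Gauss' lemma the iterated polynomial ring over a field is factorial, so irreducible
  elements are prime there; \<open>nested\<close> carries this back.\<close>

lemma tpoly_irreducible_dvd_mult:
  fixes F :: "'a::field tpoly"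
  assumes "irreducible F" "F dvd G * H"
  shows "F dvd G \<or> F dvd H"
proof -
  have "prime_elem (nested F)"
    using assms(1) by (simp add: ufd_class.prime_elem_iff_irreducible irreducible_nested)
  moreover have "nested F dvd nested G * nested H"
    using assms(2) by (simp add: nested_dvd_iff flip: nested_mult)
  ultimately show ?thesis
    by (simp add: prime_elem_dvd_mult_iff nested_dvd_iff)
qed

section \<open>Forms\<close>

lemma form_iff_lookup:
  "form_of_degree F d \<longleftrightarrow> F \<noteq> 0 \<and> (\<forall>i j k. Poly_Mapping.lookup F (i, j, k) \<noteq> 0 \<longrightarrow> i + j + k = d)"
  by (simp add: form_of_degree_def mdeg_def in_keys_iff Ball_def split_paired_all)

lemma form_nonzero: "form_of_degree F d \<Longrightarrow> F \<noteq> 0"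
  by (simp add: form_of_degree_def)

lemma form_unique_degree: "form_of_degree F a \<Longrightarrow> form_of_degree F b \<Longrightarrow> a = b"
proof -
  assume a: "form_of_degree F a" and b: "form_of_degree F b"
  then have "Poly_Mapping.keys F \<noteq> {}" by (simp add: form_of_degree_def)
  then obtain m where "m \<in> Poly_Mapping.keys F" by blast
  then show "a = b" using a b unfolding form_of_degree_def by metis
qed

lemma form_lookup_eq_0: "form_of_degree F d \<Longrightarrow> i + j + k \<noteq> d \<Longrightarrow> Poly_Mapping.lookup F (i, j, k) = 0"
  by (auto simp: form_iff_lookup)

lemma teval_homogeneous:
  assumes "comm_ring_hom h" "form_of_degree F d"
  shows "teval h F (t * x) (t * y) (t * z) = t ^ d * teval h F x y z"
  using assms by (intro teval_form) (auto simp: form_of_degree_def)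

text \<open>This is F(tX, tY, tZ) with a new outermost variable t, so the coefficient of t^n is the
  homogeneous component of degree n, and forms become monomials in t.\<close>

definition graded :: "'a::comm_ring_1 tpoly \<Rightarrow> 'a poly poly poly poly" where
  "graded F = teval (\<lambda>c. [:const3 c:]) F (monom [:[:[:0, 1:]:]:] 1) (monom [:[:0, 1:]:] 1) (monom [:0, 1:] 1)"

lemma const4_hom: "comm_ring_hom (\<lambda>c::'a::comm_ring_1. [:const3 c:])"
  by unfold_locales auto

lemma graded_mult: "graded (F * G) = graded F * graded G"
  by (simp add: graded_def teval_mult[OF const4_hom])

lemma coeff_graded:
  "coeff (coeff (coeff (coeff (graded F) n) c) b) a =
     (if a + b + c = n then Poly_Mapping.lookup F (a, b, c) else 0)"
proof -
  let ?n = "\<lambda>m k. const3 k * tmono m [:[:[:0, 1:]:]:] [:[:0, 1:]:] [:0, 1:]"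
  have "[:const3 k:] * tmono (i, j, l) (monom [:[:[:0, 1:]:]:] 1) (monom [:[:0, 1:]:] 1) (monom [:0, 1:] 1)
      = monom (?n (i, j, l) k) (i + j + l)" for k :: 'a and i j l
    by (simp add: tmono_def monom_power mult_monom smult_monom mult_ac add_ac)
  then have "[:const3 k:] * tmono m (monom [:[:[:0, 1:]:]:] 1) (monom [:[:0, 1:]:] 1) (monom [:0, 1:] 1)
      = monom (?n m k) (mdeg m)" for k :: 'a and m
    by (cases m) (simp add: mdeg_def)
  then have "coeff (coeff (coeff (coeff (graded F) n) c) b) a =
     (\<Sum>m\<in>Poly_Mapping.keys F. if mdeg m = n then coeff (coeff (coeff (?n m (Poly_Mapping.lookup F m)) c) b) a else 0)"
    unfolding graded_def teval_def by (simp add: coeff_sum if_distrib if_distribR cong: if_cong)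
  also have "\<dots> = (\<Sum>m\<in>Poly_Mapping.keys F. if mdeg m = n \<and> m = (a, b, c) then Poly_Mapping.lookup F m else 0)"
    by (intro sum.cong refl) (simp only: coeff_nested_monomial when_def split: if_splits, simp)
  also have "\<dots> = (\<Sum>m\<in>Poly_Mapping.keys F. if m = (a, b, c) then if a + b + c = n then Poly_Mapping.lookup F m else 0 else 0)"
    by (intro sum.cong) (auto simp: mdeg_def)
  also have "\<dots> = (if a + b + c = n then Poly_Mapping.lookup F (a, b, c) else 0)"
    by (auto simp: in_keys_iff)
  finally show ?thesis .
qed

text \<open>Order at 0 and degree are both additive, and the order never exceeds the degree. For a
  monomial the two totals agree, so they agree for each factor.\<close>

lemma monom_if_dvd_monom:
  fixes p q :: "'a::idom poly"
  assumes "p * q = monom c n" "c \<noteq> 0"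
  shows "p = monom (coeff p (degree p)) (degree p)"
proof -
  have nz: "p \<noteq> 0" "q \<noteq> 0" using assms by auto
  have "order 0 p + order 0 q = n"
    using assms by (metis order_mult order_0_monom monom_eq_0_iff)
  moreover have "degree p + degree q = n"
    using assms nz by (metis degree_mult_eq degree_monom_eq)
  moreover have "order 0 p \<le> degree p" "order 0 q \<le> degree q"
    using nz by (simp_all add: order_degree)
  ultimately have "order 0 p = degree p" by linarith
  then have "monom 1 (degree p) dvd p" using nz by (simp add: monom_1_dvd_iff)
  then have "i < degree p \<Longrightarrow> coeff p i = 0" for i
    by (simp add: monom_1_dvd_iff')
  then show ?thesis
    by (intro poly_eqI) (metis coeff_eq_0 coeff_monom linorder_neqE_nat)
qed

lemma form_iff_graded:
  "form_of_degree F d \<longleftrightarrow> F \<noteq> 0 \<and> graded F = monom (coeff (graded F) d) d"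
proof -
  have "graded F = monom (coeff (graded F) d) d" if "form_of_degree F d"
    using that by (intro poly_eqI) (auto simp: coeff_graded form_lookup_eq_0)
  moreover have "i + j + k = d"
    if "graded F = monom (coeff (graded F) d) d" "Poly_Mapping.lookup F (i, j, k) \<noteq> 0" for i j k
  proof (rule ccontr)
    assume "i + j + k \<noteq> d"
    then have "coeff (graded F) (i + j + k) = 0" by (subst that(1)) simp
    then show False using coeff_graded[of F "i + j + k" k j i] that(2) by simp
  qed
  ultimately show ?thesis by (metis form_iff_lookup)
qed

lemma graded_eq_0_iff: "graded F = 0 \<longleftrightarrow> F = 0"
proof
  assume "graded F = 0"
  then have "Poly_Mapping.lookup F (a, b, c) = 0" for a b c
    using coeff_graded[of F "a + b + c" c b a] by simp
  then show "F = 0" by (intro poly_mapping_eqI) (metis lookup_zero prod.exhaust)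
qed (simp add: graded_def teval_0[OF const4_hom])

text \<open>In the variable t of \<open>graded\<close> a form is a monomial, and factors of a
  monomial over a domain are monomials.\<close>

lemma form_mult_form:
  fixes A B :: "'a::field tpoly"
  assumes "form_of_degree (A * B) d"
  obtains a b where "form_of_degree A a" "form_of_degree B b" "a + b = d"
proof -
  have nz: "A \<noteq> 0" "B \<noteq> 0" using assms by (auto dest: form_nonzero)
  let ?c = "coeff (graded (A * B)) d"
  have eq: "graded A * graded B = monom ?c d"
    using assms by (simp add: form_iff_graded flip: graded_mult)
  moreover have "?c \<noteq> 0"
    using eq nz by (metis graded_eq_0_iff monom_eq_0_iff mult_eq_0_iff)
  ultimately have "graded A = monom (coeff (graded A) (degree (graded A))) (degree (graded A))"
    "graded B = monom (coeff (graded B) (degree (graded B))) (degree (graded B))"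
    by (blast intro: monom_if_dvd_monom, metis monom_if_dvd_monom mult.commute)
  moreover have "degree (graded A) + degree (graded B) = d"
    using eq \<open>?c \<noteq> 0\<close> nz by (metis degree_mult_eq degree_monom_eq graded_eq_0_iff)
  ultimately show thesis using that nz by (auto simp: form_iff_graded)
qed

lemma form_mult:
  fixes A B :: "'a::field tpoly"
  assumes "form_of_degree A a" "form_of_degree B b"
  shows "form_of_degree (A * B) (a + b)"
proof -
  have "graded (A * B) = monom (coeff (graded A) a * coeff (graded B) b) (a + b)"
    using assms by (metis form_iff_graded graded_mult mult_monom)
  moreover have "A * B \<noteq> 0" using assms by (simp add: tpoly_mult_eq_0 form_nonzero)
  ultimately show ?thesis by (simp add: form_iff_graded)
qed

lemma form_0_iff_tconst: "form_of_degree F 0 \<longleftrightarrow> (\<exists>c. c \<noteq> 0 \<and> F = tconst c)"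
proof
  assume F: "form_of_degree F 0"
  then have "F = tconst (Poly_Mapping.lookup F (0, 0, 0))"
    by (intro poly_mapping_eqI) (auto simp: tconst_def lookup_single when_def form_iff_lookup)
  then show "\<exists>c. c \<noteq> 0 \<and> F = tconst c"
    using form_nonzero[OF F] by (metis tconst_def single_zero)
next
  assume "\<exists>c. c \<noteq> 0 \<and> F = tconst c"
  moreover have "tconst c \<noteq> 0" if "c \<noteq> 0" for c :: 'a
    using that by (metis lookup_single_eq lookup_zero tconst_def)
  ultimately show "form_of_degree F 0"
    by (auto simp: form_iff_lookup tconst_def lookup_single when_def split: if_splits)
qed

lemma tpoly_unit_iff: "F dvd 1 \<longleftrightarrow> (\<exists>c. c \<noteq> 0 \<and> F = tconst c)"
  for F :: "'a::field tpoly"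
proof
  assume "F dvd 1"
  then obtain G where "1 = F * G" by (rule dvdE)
  moreover have "form_of_degree (1 :: 'a tpoly) 0"
    unfolding form_0_iff_tconst by (intro exI[of _ 1]) (simp add: tconst_def flip: zero_prod_def)
  ultimately obtain a b where "form_of_degree F a" "a + b = 0" by (metis form_mult_form)
  then show "\<exists>c. c \<noteq> 0 \<and> F = tconst c" by (simp add: form_0_iff_tconst)
next
  assume "\<exists>c. c \<noteq> 0 \<and> F = tconst c"
  then obtain c where c: "c \<noteq> 0" "F = tconst c" by blast
  have "F * tconst (inverse c) = 1"
    using c by (simp add: tconst_def mult_single flip: zero_prod_def)
  then show "F dvd 1" by (metis dvd_triv_left)
qed

lemma coeff_X10:
  assumes "form_of_degree F d"
  shows "coeff (teval const1 F [:0, 1:] 1 0) i = (if i \<le> d then Poly_Mapping.lookup F (i, d - i, 0) else 0)"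
proof -
  have *: "coeff ([:Poly_Mapping.lookup F m:] * tmono m [:0, 1:] 1 0) i =
      (if m = (i, d - i, 0) then if i \<le> d then Poly_Mapping.lookup F m else 0 else 0)"
    if "m \<in> Poly_Mapping.keys F" for m
    using that assms
    by (cases m) (auto simp: tmono_def pCons_0_1_power form_of_degree_def mdeg_def power_0_left)
  have "coeff (teval const1 F [:0, 1:] 1 0) i =
     (\<Sum>m\<in>Poly_Mapping.keys F. if m = (i, d - i, 0) then if i \<le> d then Poly_Mapping.lookup F m else 0 else 0)"
    unfolding teval_def coeff_sum by (intro sum.cong refl *)
  then show ?thesis by (auto simp: in_keys_iff)
qed

lemma coeff_1X0:
  assumes "form_of_degree F d"
  shows "coeff (teval const1 F 1 [:0, 1:] 0) j = (if j \<le> d then Poly_Mapping.lookup F (d - j, j, 0) else 0)"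
proof -
  have *: "coeff ([:Poly_Mapping.lookup F m:] * tmono m 1 [:0, 1:] 0) j =
      (if m = (d - j, j, 0) then if j \<le> d then Poly_Mapping.lookup F m else 0 else 0)"
    if "m \<in> Poly_Mapping.keys F" for m
    using that assms
    by (cases m) (auto simp: tmono_def pCons_0_1_power form_of_degree_def mdeg_def power_0_left)
  have "coeff (teval const1 F 1 [:0, 1:] 0) j =
     (\<Sum>m\<in>Poly_Mapping.keys F. if m = (d - j, j, 0) then if j \<le> d then Poly_Mapping.lookup F m else 0 else 0)"
    unfolding teval_def coeff_sum by (intro sum.cong refl *)
  then show ?thesis by (auto simp: in_keys_iff)
qed

lemma teval_unit_vectors:
  assumes "form_of_degree F d"
  shows "teval (\<lambda>c. c) F 1 0 0 = Poly_Mapping.lookup F (d, 0, 0)"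
    and "teval (\<lambda>c. c) F 0 0 1 = Poly_Mapping.lookup F (0, 0, d)"
proof -
  have 1: "Poly_Mapping.lookup F m * tmono m 1 0 0 = (if m = (d, 0, 0) then Poly_Mapping.lookup F m else 0)"
    and 2: "Poly_Mapping.lookup F m * tmono m 0 0 1 = (if m = (0, 0, d) then Poly_Mapping.lookup F m else 0)"
    if "m \<in> Poly_Mapping.keys F" for m
    using that assms
    by (cases m; auto simp: tmono_def form_of_degree_def mdeg_def power_0_left)+
  show "teval (\<lambda>c. c) F 1 0 0 = Poly_Mapping.lookup F (d, 0, 0)"
    unfolding teval_def by (subst sum.cong[OF refl 1]) (auto simp: in_keys_iff)
  show "teval (\<lambda>c. c) F 0 0 1 = Poly_Mapping.lookup F (0, 0, d)"
    unfolding teval_def by (subst sum.cong[OF refl 2]) (auto simp: in_keys_iff)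
qed

lemma varZ_dvd_iff: "varZ dvd F \<longleftrightarrow> (\<forall>i j. Poly_Mapping.lookup F (i, j, 0) = 0)"
proof -
  have "varZ dvd F \<longleftrightarrow> [:0, 1:] dvd nested F"
    using nested_dvd_iff[of varZ F] by (simp only: nested_def[of varZ] teval_var[OF const3_hom])
  also have "\<dots> \<longleftrightarrow> coeff (nested F) 0 = 0"
    using poly_eq_0_iff_dvd[of "nested F" 0] by (simp add: poly_0_coeff_0)
  also have "\<dots> \<longleftrightarrow> (\<forall>i j. Poly_Mapping.lookup F (i, j, 0) = 0)"
    by (auto simp: poly_eq_iff coeff_nested[symmetric])
  finally show ?thesis .
qed

lemma varZ_dvd_if_X10_eq_0:
  assumes "form_of_degree F d" "teval const1 F [:0, 1:] 1 0 = 0"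
  shows "varZ dvd F"
  unfolding varZ_dvd_iff
proof (intro allI)
  fix i j show "Poly_Mapping.lookup F (i, j, 0) = 0"
    using coeff_X10[OF assms(1), of i] assms(2) form_lookup_eq_0[OF assms(1), of i j 0]
    by (cases "i + j = d") auto
qed

section \<open>Univariate polynomials with symmetries\<close>

\<comment> \<open>Otherwise \<open>[:a, 1:]\<close> simplifies to \<open>pCons a 1\<close>, which rules about \<open>[:a, 1:]\<close> do not match.\<close>
declare pCons_one [simp del]

lemma prod_linear_factors_dvd:
  fixes R :: "'a::idom poly"
  assumes "finite T" "\<And>s. s \<in> T \<Longrightarrow> poly R s = 0"
  shows "(\<Prod>s\<in>T. [:- s, 1:]) dvd R"
  using assms
proof (induction T arbitrary: R rule: finite_induct)
  case (insert s T)
  then obtain R' where R': "R = [:- s, 1:] * R'" by (metis dvdE insertI1 poly_eq_0_iff_dvd)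
  have "poly R' t = 0" if "t \<in> T" for t
    using insert.prems[of t] insert.hyps that by (auto simp: R')
  then have "(\<Prod>s\<in>T. [:- s, 1:]) dvd R'" by (rule insert.IH)
  then show ?case unfolding R' using insert.hyps by (simp add: mult_dvd_mono del: mult_pCons_left)
qed simp

text \<open>Here \<open>S\<close> is a finite additive group. P - P(0) vanishes on \<open>S\<close>
  and is thus divisible by the product m of the linear factors; m is itself translation invariant,
  so the quotient is too, and induction on the degree expands P in powers of m.\<close>

lemma translation_invariant_decompose:
  fixes P :: "'a::idom poly"
  assumes fin: "finite S" and S: "0 \<in> S" "\<And>s t. s \<in> S \<Longrightarrow> t \<in> S \<Longrightarrow> t - s \<in> S"
    and inv: "\<And>s. s \<in> S \<Longrightarrow> pcompose P [:s, 1:] = P"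
  shows "\<exists>Q. P = pcompose Q (\<Prod>s\<in>S. [:- s, 1:])"
  using inv
proof (induction "degree P" arbitrary: P rule: less_induct)
  case less
  define m where "m = (\<Prod>s\<in>S. [:- s, 1:])"
  have neg: "- s \<in> S" if "s \<in> S" for s using S(2)[OF that S(1)] by simp
  have add: "s + t \<in> S" if "s \<in> S" "t \<in> S" for s t using S(2)[OF neg[OF that(1)] that(2)] by (simp add: add.commute)
  have m_inv: "pcompose m [:s, 1:] = m" if "s \<in> S" for s
  proof -
    have "pcompose m [:s, 1:] = (\<Prod>t\<in>S. [:- (t - s), 1:])"
      by (simp add: m_def pcompose_prod pcompose_pCons)
    also have "\<dots> = (\<Prod>t\<in>S. [:- t, 1:])"
      by (rule prod.reindex_bij_witness[of _ "\<lambda>t. t + s" "\<lambda>t. t - s"]) (use S that add in auto)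
    finally show ?thesis by (simp add: m_def)
  qed
  have mnz: "m \<noteq> 0" using fin by (simp add: m_def)
  have degm: "degree m = card S" using fin by (simp add: m_def degree_prod_eq_sum_degree)
  have "card S > 0" using fin S(1) card_gt_0_iff by blast
  have root: "poly P s = poly P 0" if "s \<in> S" for s
  proof -
    have "poly P s = poly (pcompose P [:s, 1:]) 0" by (simp add: poly_pcompose)
    then show ?thesis using less.prems[OF that] by simp
  qed
  have "m dvd P - [:poly P 0:]"
    unfolding m_def by (rule prod_linear_factors_dvd[OF fin]) (simp add: root)
  then obtain P1 where P1: "P = [:poly P 0:] + m * P1" by (metis add_diff_cancel_left' diff_add_cancel dvdE add.commute)
  have inv1: "pcompose P1 [:s, 1:] = P1" if "s \<in> S" for s
  proof -
    have "P = pcompose ([:poly P 0:] + m * P1) [:s, 1:]" using less.prems[OF that] P1 by simp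
    also have "\<dots> = [:poly P 0:] + m * pcompose P1 [:s, 1:]"
      by (simp add: pcompose_add pcompose_mult m_inv[OF that] del: mult_cancel_left)
    finally have "m * pcompose P1 [:s, 1:] = m * P1" using P1 by (metis add_left_cancel)
    then show ?thesis using mnz by simp
  qed
  have "\<exists>Q. P1 = pcompose Q m"
  proof (cases "P1 = 0")
    case False
    have "degree (m * P1) \<le> degree P"
      using P1 by (metis add_diff_cancel_left' degree_diff_le degree_pCons_0 le0 order_refl)
    then have "degree P1 < degree P"
      using False mnz degm \<open>card S > 0\<close> by (simp add: degree_mult_eq)
    then show ?thesis using less.hyps[OF _ inv1] by (simp add: m_def)
  qed (auto intro!: exI[of _ 0])
  then obtain Q where "P1 = pcompose Q m" by blast
  then have "P = pcompose (pCons (poly P 0) Q) m" using P1 by (simp add: pcompose_pCons)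
  then show ?case unfolding m_def by blast
qed

lemma pcompose_scale_coeff:
  assumes "pcompose P [:0, c::'a::idom:] = P"
  shows "coeff P k * c ^ k = coeff P k"
proof -
  have "coeff (pcompose P [:0, c:]) k = c ^ k * coeff P k" by (rule coeff_pcompose_linear)
  then show ?thesis using assms by (simp add: mult.commute)
qed

lemma pcompose_cancel:
  fixes A B m :: "'a::idom poly"
  assumes "pcompose A m = pcompose B m" "degree m > 0"
  shows "A = B"
proof -
  have "pcompose (A - B) m = 0" using assms by (simp add: pcompose_diff)
  then show ?thesis using assms(2) pcompose_eq_0[of "A - B" m] by simp
qed

lemma pcompose_monom_1: "pcompose (monom 1 k) r = r ^ k" for r :: "'a::comm_ring_1 poly"
  by (induction k) (simp_all add: monom_0 monom_Suc pcompose_pCons pCons_one)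

lemma map_poly_comm_ring_hom:
  assumes "comm_ring_hom h"
  shows "comm_ring_hom (map_poly h)"
proof -
  interpret h: comm_ring_hom h by (rule assms)
  show ?thesis
    by unfold_locales
       (auto intro!: poly_eqI simp: coeff_map_poly coeff_mult h.hom_add h.hom_mult h.hom_sum)
qed

section \<open>The subfield of order q and its Frobenius map\<close>

locale finite_subfield =
  fixes p n q :: nat and ty :: "'a::field itself"
  assumes p: "prime p" and n: "n \<ge> 1" and q: "q = p ^ n"
    and char: "of_nat p = (0::'a)"
    and alg: "alg_closed TYPE('a)"
begin

definition Fq :: "'a set" where "Fq = {a. a ^ q = a}"

lemma q_ge_2: "q \<ge> 2"
proof -
  have "2 \<le> p" using p by (rule prime_ge_2_nat)
  also have "p = p ^ 1" by simp
  also have "\<dots> \<le> p ^ n" using n prime_gt_0_nat[OF p] by (intro power_increasing) auto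
  finally show ?thesis by (simp add: q)
qed

lemma q_pos: "q > 0" using q_ge_2 by simp

lemma of_nat_q: "of_nat q = (0::'a)"
  using char n by (simp add: q power_0_left)

text \<open>Stated for every ring in which \<open>p\<close> vanishes because it is applied in K, in
  polynomial rings and in \<open>tpoly\<close>. The characteristic divides \<open>p\<close> and is
  not 1, so it equals \<open>p\<close>.\<close>

lemma frobenius_add:
  fixes x y :: "'b::comm_ring_1"
  assumes "of_nat p = (0::'b)"
  shows "(x + y) ^ q = x ^ q + y ^ q"
proof -
  have "CHAR('b) dvd p" using assms by (simp add: of_nat_eq_0_iff_char_dvd)
  moreover have "CHAR('b) \<noteq> 1" by simp
  ultimately have "CHAR('b) = p" using p prime_nat_iff by blast
  then show ?thesis using freshmans_dream'[of q n x y] p q by simp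
qed

lemma frobenius_minus:
  fixes x :: "'b::comm_ring_1"
  assumes "of_nat p = (0::'b)"
  shows "(- x) ^ q = - (x ^ q)"
proof -
  have "x ^ q + (- x) ^ q = 0"
    using frobenius_add[OF assms, of x "- x"] q_pos by (simp add: power_0_left)
  then show ?thesis by (simp add: eq_neg_iff_add_eq_0 add.commute)
qed

lemma frobenius_diff:
  fixes x y :: "'b::comm_ring_1"
  assumes "of_nat p = (0::'b)"
  shows "(x - y) ^ q = x ^ q - y ^ q"
  using frobenius_add[OF assms, of x "- y"] frobenius_minus[OF assms] by simp

lemma of_nat_p_poly: "of_nat p = (0 :: 'a poly)"
  by (simp add: of_nat_poly char)

lemma of_nat_p_tpoly: "of_nat p = (0 :: 'a tpoly)"
  by (intro poly_mapping_eqI) (simp add: char lookup_of_nat when_def)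

lemma Fq_0: "0 \<in> Fq" and Fq_1: "1 \<in> Fq"
  using q_pos by (auto simp: Fq_def)

lemma Fq_diff: "a \<in> Fq \<Longrightarrow> b \<in> Fq \<Longrightarrow> a - b \<in> Fq"
  by (simp add: Fq_def frobenius_diff[OF char])

lemma Fq_uminus: "a \<in> Fq \<Longrightarrow> - a \<in> Fq"
  using Fq_diff[OF Fq_0] by force

lemma Fq_roots: "Fq = {a. poly (monom 1 q - [:0, 1:]) a = 0}"
  by (auto simp: Fq_def poly_monom)

lemma degree_q_poly: "degree (monom 1 q - [:0, 1::'a:]) = q"
proof -
  have "degree [:0, 1::'a:] < degree (monom (1::'a) q)" using q_ge_2 by (simp add: degree_monom_eq)
  then show ?thesis
    by (simp add: degree_monom_eq degree_add_eq_left flip: add_uminus_conv_diff)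
qed

lemma finite_Fq: "finite Fq"
proof -
  have "monom 1 q - [:0, 1::'a:] \<noteq> 0" using degree_q_poly q_pos by auto
  then show ?thesis unfolding Fq_roots by (rule poly_roots_finite)
qed

text \<open>The cofactor of the product in X^q - X is constant: a root of it would be a multiple
  root of X^q - X, whose derivative is -1. Comparing degrees then counts the field.\<close>

lemma prod_Fq: "(\<Prod>a\<in>Fq. [:- a, 1:]) = monom 1 q - [:0, 1:]" and card_Fq: "card Fq = q"
proof -
  let ?f = "monom 1 q - [:0, 1::'a:]" and ?m = "\<Prod>a\<in>Fq. [:- a, 1:]"
  have fnz: "?f \<noteq> 0" using degree_q_poly q_pos by auto
  have "?m dvd ?f"
    by (rule prod_linear_factors_dvd[OF finite_Fq]) (unfold Fq_roots, blast)
  then obtain r where r: "?f = ?m * r" by (rule dvdE)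
  have "degree r = 0"
  proof (rule ccontr)
    assume "degree r \<noteq> 0"
    then obtain x where x: "poly r x = 0" using alg by (auto simp: alg_closed_def)
    then have "poly ?f x = 0" by (simp only: r poly_mult) simp
    then have "x \<in> Fq" unfolding Fq_roots by blast
    then have "poly ?m x = 0" using finite_Fq by (auto simp: poly_prod)
    then have "poly (pderiv ?f) x = 0" using x by (simp only: r pderiv_mult) simp
    moreover have "pderiv ?f = [:-1:]"
      using of_nat_q by (simp add: pderiv_diff pderiv_monom pderiv_pCons)
    ultimately show False by simp
  qed
  then obtain c where c: "r = [:c:]" by (metis degree_eq_zeroE)
  have "lead_coeff ?m = 1" by (simp add: lead_coeff_prod)
  moreover have "lead_coeff ?f = 1" using degree_q_poly q_ge_2 by (simp add: coeff_pCons split: nat.split)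
  ultimately have "c = 1" by (metis c lead_coeff_mult lead_coeff_pCons(2) mult_1 fnz r mult_zero_right pCons_0_0)
  then show *: "?m = ?f" using r c by simp
  have "degree ?m = card Fq" by (simp add: degree_prod_eq_sum_degree)
  then show "card Fq = q" using * degree_q_poly by simp
qed

text \<open>The polynomial X^k - 1 has at most k roots, fewer than the q - 1 units of
  \<open>Fq\<close>.\<close>

lemma exists_Fq_power_neq_1:
  assumes "0 < k" "k < q - 1"
  shows "\<exists>c\<in>Fq - {0}. c ^ k \<noteq> 1"
proof (rule ccontr)
  assume "\<not> ?thesis"
  then have sub: "Fq - {0} \<subseteq> {x. poly (monom 1 k - 1) x = 0}" by (auto simp: poly_monom)
  have nz: "monom 1 k - 1 \<noteq> (0::'a poly)"
    using assms by (metis degree_1 degree_monom_eq eq_iff_diff_eq_0 less_irrefl zero_neq_one)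
  have "q - 1 = card (Fq - {0})" using card_Fq Fq_0 finite_Fq by simp
  also have "\<dots> \<le> card {x. poly (monom 1 k - 1::'a poly) x = 0}"
    using sub nz poly_roots_finite by (intro card_mono) blast+
  also have "\<dots> \<le> degree (monom 1 k - 1::'a poly)" using nz by (rule card_poly_roots_bound)
  also have "\<dots> \<le> k" by (intro degree_diff_le) (auto simp: degree_monom_le)
  finally show False using assms by simp
qed

text \<open>Scaling multiplies the k-th coefficient by c^k, and c can be chosen with c^k different
  from 1. The embedding \<open>h\<close> lets the coefficients themselves be polynomials.\<close>

lemma scale_invariant_coeff:
  fixes P :: "'b::idom poly"
  assumes "inj h" "comm_ring_hom h"
    and "\<And>c. c \<in> Fq - {0} \<Longrightarrow> pcompose P [:0, h c:] = P" "0 < k" "k < q - 1"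
  shows "coeff P k = 0"
proof -
  interpret h: comm_ring_hom h by fact
  obtain c where c: "c \<in> Fq - {0}" "c ^ k \<noteq> 1" using exists_Fq_power_neq_1 assms by blast
  have "coeff P k * h c ^ k = coeff P k" by (rule pcompose_scale_coeff) (use assms c in auto)
  then have "coeff P k = 0 \<or> h c ^ k = 1" by (metis mult_cancel_left mult_1_right)
  moreover have "h c ^ k \<noteq> 1"
    using c(2) injD[OF assms(1), of "c ^ k" 1] by (auto simp: h.hom_power)
  ultimately show ?thesis by simp
qed

section \<open>Forms invariant under perspectivities\<close>

text \<open>The three families have the axes Z = 0, Y = 0 and X = 0, which they fix pointwise.
  Demanding equality instead of proportionality makes the condition linear in F, so that invariant
  forms can be subtracted.\<close>

definition perspectivity_invariant :: "'a tpoly \<Rightarrow> bool" where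
  "perspectivity_invariant F \<longleftrightarrow> (\<forall>a\<in>Fq. \<forall>b\<in>Fq. \<forall>c\<in>Fq - {0}.
     tsubst F (varX + tconst a * varZ) (varY + tconst b * varZ) (tconst c * varZ) = F \<and>
     tsubst F (varX + tconst a * varY) (tconst c * varY) (varZ + tconst b * varY) = F \<and>
     tsubst F (tconst c * varX) (varY + tconst a * varX) (varZ + tconst b * varX) = F)"

lemma perspectivity_teval:
  assumes F: "perspectivity_invariant F" and h: "comm_ring_hom h"
    and "a \<in> Fq" "b \<in> Fq" "c \<in> Fq - {0}"
  shows "teval h F (x + h a * z) (y + h b * z) (h c * z) = teval h F x y z"
    and "teval h F (x + h a * y) (h c * y) (z + h b * y) = teval h F x y z"
    and "teval h F (h c * x) (y + h a * x) (z + h b * x) = teval h F x y z"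
proof -
  note s = teval_tsubst[OF h] teval_simps[OF h]
  have e: "tsubst F (varX + tconst a * varZ) (varY + tconst b * varZ) (tconst c * varZ) = F"
     "tsubst F (varX + tconst a * varY) (tconst c * varY) (varZ + tconst b * varY) = F"
     "tsubst F (tconst c * varX) (varY + tconst a * varX) (varZ + tconst b * varX) = F"
    using assms unfolding perspectivity_invariant_def by blast+
  show "teval h F (x + h a * z) (y + h b * z) (h c * z) = teval h F x y z"
    using arg_cong[OF e(1), of "\<lambda>F. teval h F x y z"] by (simp add: s)
  show "teval h F (x + h a * y) (h c * y) (z + h b * y) = teval h F x y z"
    using arg_cong[OF e(2), of "\<lambda>F. teval h F x y z"] by (simp add: s)
  show "teval h F (h c * x) (y + h a * x) (z + h b * x) = teval h F x y z"
    using arg_cong[OF e(3), of "\<lambda>F. teval h F x y z"] by (simp add: s)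
qed

lemma Fq_unit: "1 \<in> Fq - {0}" using Fq_1 by simp

lemma perspectivity_translate:
  assumes F: "perspectivity_invariant F" and h: "comm_ring_hom h" and a: "a \<in> Fq"
  shows "teval h F (x + h a * z) y z = teval h F x y z"
    and "teval h F (x + h a * y) y z = teval h F x y z"
    and "teval h F x (y + h a * x) z = teval h F x y z"
    and "teval h F x y (z + h a * y) = teval h F x y z"
    and "teval h F x y (z + h a * x) = teval h F x y z"
proof -
  interpret h: comm_ring_hom h by (rule h)
  note [simp] = h.hom_zero h.hom_one
  show "teval h F (x + h a * z) y z = teval h F x y z"
    using perspectivity_teval(1)[OF F h a Fq_0 Fq_unit, of x z y] by simp
  show "teval h F (x + h a * y) y z = teval h F x y z"
    using perspectivity_teval(2)[OF F h a Fq_0 Fq_unit, of x y z] by simp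
  show "teval h F x (y + h a * x) z = teval h F x y z"
    using perspectivity_teval(3)[OF F h a Fq_0 Fq_unit, of x y z] by simp
  show "teval h F x y (z + h a * y) = teval h F x y z"
    using perspectivity_teval(2)[OF F h Fq_0 a Fq_unit, of x y z] by simp
  show "teval h F x y (z + h a * x) = teval h F x y z"
    using perspectivity_teval(3)[OF F h Fq_0 a Fq_unit, of x y z] by simp
qed

lemma perspectivity_scale:
  assumes F: "perspectivity_invariant F" and h: "comm_ring_hom h" and c: "c \<in> Fq - {0}"
  shows "teval h F (h c * x) y z = teval h F x y z"
    and "teval h F x y (h c * z) = teval h F x y z"
proof -
  interpret h: comm_ring_hom h by (rule h)
  note [simp] = h.hom_zero h.hom_one
  show "teval h F (h c * x) y z = teval h F x y z"
    using perspectivity_teval(3)[OF F h Fq_0 Fq_0 c, of x y z] by simp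
  show "teval h F x y (h c * z) = teval h F x y z"
    using perspectivity_teval(1)[OF F h Fq_0 Fq_0 c, of x z y] by simp
qed

lemma perspectivity_invariant_diff:
  assumes "perspectivity_invariant F" "perspectivity_invariant G"
  shows "perspectivity_invariant (F - tconst t * G)"
  using assms unfolding perspectivity_invariant_def
  by (simp add: tsubst_eq_teval teval_simps[OF tconst_hom])

lemma perspectivity_invariant_swap:
  assumes "perspectivity_invariant F"
  shows "perspectivity_invariant (tsubst F varY varX varZ)"
proof -
  note pt = perspectivity_teval[OF assms tconst_hom]
  have "tsubst (tsubst F varY varX varZ) u v w = teval tconst F v u w" for u v w
    by (simp add: tsubst_eq_teval hom_teval[OF tconst_hom teval_hom[OF tconst_hom]] teval_simps[OF tconst_hom])
  then show ?thesis unfolding perspectivity_invariant_def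
    using pt by (simp add: tsubst_eq_teval)
qed

lemma degree_additive: "degree (monom 1 q - [:0, 1::'a:]) > 0"
  using degree_q_poly q_pos by simp

lemma degree_monom_q: "degree (monom (1::'a) q) > 0"
  using q_pos by (simp add: degree_monom_eq)

text \<open>Two decompositions by translation groups give f = R(X^(q^2) - X^q); the degree bound
  gives deg R < q, and the scalings by \<open>Fq\<close> remove all exponents strictly between 0 and
  q - 1.\<close>

lemma invariant_restriction_to_line:
  assumes F: "perspectivity_invariant F"
    and deg: "degree (teval const1 F [:0, 1:] 1 0) < q ^ 3 - q"
  obtains \<alpha> \<beta> where "teval const1 F [:0, 1:] 1 0 = [:\<alpha>:] + smult \<beta> ((monom 1 (q ^ 2) - monom 1 q) ^ (q - 1))"
proof -
  define f where "f = teval const1 F [:0, 1:] 1 0"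
  \<comment> \<open>Y = 1, the outer variable is X and the inner one is Z. Keeping Z free makes the
    translations by aZ, which are trivial on Z = 0, act effectively.\<close>
  define P where "P = teval const2 F [:0, 1:] 1 [:[:0, 1:]:]"
  let ?m = "monom 1 q - [:0, 1::'a:]"
  define S where "S = (\<lambda>a. [:0, a:]) ` Fq"
  have inj: "inj_on (\<lambda>a::'a. [:0, a:]) Fq" by (auto simp: inj_on_def)
  have "\<exists>Q. P = pcompose Q (\<Prod>s\<in>S. [:- s, 1:])"
  proof (rule translation_invariant_decompose)
    show "finite S" "0 \<in> S" using finite_Fq Fq_0 by (auto simp: S_def image_iff intro!: bexI[of _ 0])
    show "t - s \<in> S" if "s \<in> S" "t \<in> S" for s t
      using that Fq_diff by (auto simp: S_def)
    fix s assume "s \<in> S"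
    then obtain a where a: "a \<in> Fq" "s = [:0, a:]" by (auto simp: S_def)
    have "pcompose P [:s, 1:] = teval const2 F ([:0, 1:] + const2 a * [:[:0, 1:]:]) 1 [:[:0, 1:]:]"
      unfolding P_def hom_teval[OF const2_hom pcompose_hom.comm_ring_hom_axioms]
      by (simp add: pcompose_pCons a pcompose_1)
    also have "\<dots> = P" unfolding P_def by (rule perspectivity_translate(1)[OF F const2_hom a(1)])
    finally show "pcompose P [:s, 1:] = P" .
  qed
  then obtain Q where Q: "P = pcompose Q (\<Prod>s\<in>S. [:- s, 1:])" by blast
  \<comment> \<open>Setting Z = 0 collapses all factors X - aZ to X, so the product becomes
    X^q.\<close>
  let ?h = "map_poly (\<lambda>r::'a poly. poly r 0)"
  have h: "comm_ring_hom ?h"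
    by (rule map_poly_comm_ring_hom) (rule poly_hom.comm_ring_hom_axioms)
  interpret h: comm_ring_hom ?h by (rule h)
  have h_pCons: "?h (pCons a r) = pCons (poly a 0) (?h r)" for a r
    by (intro poly_eqI) (simp add: coeff_map_poly coeff_pCons split: nat.split)
  have "card S = q" unfolding S_def using card_image[OF inj] card_Fq by simp
  moreover have "?h [:- s, 1:] = [:0, 1:]" if "s \<in> S" for s
    using that by (auto simp: S_def h_pCons)
  ultimately have "?h (\<Prod>s\<in>S. [:- s, 1:]) = monom 1 q"
    by (simp add: h.hom_prod monom_altdef)
  moreover have "?h P = f"
    unfolding P_def f_def hom_teval[OF const2_hom h] by (simp add: h_pCons)
  ultimately have f1: "f = pcompose (?h Q) (monom 1 q)"
    using arg_cong[OF Q, of ?h] by (simp add: poly_hom.map_poly_pcompose)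
  have f_inv: "pcompose f [:a, 1:] = f" if "a \<in> Fq" for a
  proof -
    have "pcompose f [:a, 1:] = teval const1 F ([:0, 1:] + [:a:] * 1) 1 0"
      unfolding f_def hom_teval[OF const1_hom pcompose_hom.comm_ring_hom_axioms]
      by (simp add: pcompose_pCons pcompose_1)
    also have "\<dots> = f" unfolding f_def by (rule perspectivity_translate(2)[OF F const1_hom that])
    finally show ?thesis .
  qed
  \<comment> \<open>Since a^q = a, translation by a commutes with raising X to the q-th power, and
    invariance descends from f to the polynomial in X^q.\<close>
  have "pcompose (?h Q) [:a, 1:] = ?h Q" if a: "a \<in> Fq" for a
  proof (rule pcompose_cancel[OF _ degree_monom_q])
    have "pcompose [:a, 1:] (monom 1 q) = [:a:] + [:0, 1:] ^ q"
      by (simp add: pcompose_pCons monom_altdef)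
    also have "\<dots> = ([:a:] + [:0, 1:]) ^ q"
      using a by (simp only: frobenius_add[OF of_nat_p_poly] const_power) (simp add: Fq_def)
    also have "\<dots> = pcompose (monom 1 q) [:a, 1:]" by (simp add: pcompose_monom_1)
    finally have "pcompose (pcompose (?h Q) [:a, 1:]) (monom 1 q) = pcompose f [:a, 1:]"
      by (simp add: f1 flip: pcompose_assoc)
    then show "pcompose (pcompose (?h Q) [:a, 1:]) (monom 1 q) = pcompose (?h Q) (monom 1 q)"
      by (simp add: f_inv[OF a] flip: f1)
  qed
  then obtain R where R: "?h Q = pcompose R ?m"
    using translation_invariant_decompose[OF finite_Fq Fq_0 Fq_diff, of "?h Q"] unfolding prod_Fq by blast
  define u where "u = monom (1::'a) (q ^ 2) - monom 1 q"
  have "pcompose ?m (monom 1 q) = u"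
    by (simp add: pcompose_diff pcompose_monom_1 pcompose_pCons u_def monom_power power2_eq_square)
  then have fR: "f = pcompose R u"
    by (simp add: f1 R flip: pcompose_assoc)
  have "q < q ^ 2" using q_ge_2 by (simp add: power2_eq_square)
  then have deg_u: "degree u = q ^ 2"
    unfolding u_def by (simp add: degree_monom_eq degree_add_eq_left flip: add_uminus_conv_diff)
  then have "degree R * q ^ 2 < q ^ 3 - q"
    using deg unfolding fR[unfolded f_def] by (simp add: degree_pcompose)
  also have "\<dots> \<le> q * q ^ 2" by (simp add: power3_eq_cube power2_eq_square)
  finally have "degree R * q ^ 2 < q * q ^ 2" .
  then have deg_R: "degree R < q" by simp
  have R_inv: "pcompose R [:0, c:] = R" if c: "c \<in> Fq - {0}" for c
  proof (rule pcompose_cancel)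
    show "degree u > 0" using deg_u q_pos by simp
    \<comment> \<open>Both exponents of u are powers of q, so u(cX) = c u(X), and the scaling
      symmetry descends from f to R.\<close>
    have "c ^ q ^ 2 = c" using c by (simp add: power2_eq_square power_mult Fq_def)
    moreover have "[:0, c:] = monom c 1" by (simp add: monom_altdef)
    ultimately have "pcompose u [:0, c:] = smult c u"
      using c by (simp add: u_def pcompose_diff pcompose_monom_1 smult_diff_right Fq_def smult_monom monom_power)
    then have "pcompose (pcompose R [:0, c:]) u = pcompose f [:0, c:]"
      by (simp add: fR pcompose_pCons flip: pcompose_assoc)
    also have "\<dots> = teval const1 F ([:c:] * [:0, 1:]) 1 0"
      unfolding f_def hom_teval[OF const1_hom pcompose_hom.comm_ring_hom_axioms]
      by (simp add: pcompose_pCons pcompose_1)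
    also have "\<dots> = pcompose R u"
      unfolding fR[symmetric] unfolding f_def by (rule perspectivity_scale(1)[OF F const1_hom c])
    finally show "pcompose (pcompose R [:0, c:]) u = pcompose R u" .
  qed
  have "coeff R k = 0" if "0 < k" "k < q - 1" for k
    using scale_invariant_coeff[OF _ comm_ring_hom_id R_inv that] by (simp add: inj_def)
  then have "R = [:coeff R 0:] + smult (coeff R (q - 1)) (monom 1 (q - 1))"
  proof (intro poly_eqI)
    fix k
    consider "k = 0" | "0 < k" "k < q - 1" | "k = q - 1" "k \<noteq> 0" | "q - 1 < k" "degree R < k"
      using deg_R by linarith
    then show "coeff R k = coeff ([:coeff R 0:] + smult (coeff R (q - 1)) (monom 1 (q - 1))) k"
      using q_ge_2 \<open>\<And>k. 0 < k \<Longrightarrow> k < q - 1 \<Longrightarrow> coeff R k = 0\<close>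
      by cases (auto simp: coeff_pCons coeff_eq_0 split: nat.split)
  qed
  then have "f = [:coeff R 0:] + smult (coeff R (q - 1)) (u ^ (q - 1))"
    unfolding fR by (metis pcompose_add pcompose_const pcompose_smult pcompose_monom_1)
  then show thesis using that unfolding f_def u_def by blast
qed

lemma power_diff_monom:
  "(monom 1 (q ^ 2) - monom 1 q) ^ (q - 1) = monom (1::'a) (q * (q - 1)) * (monom 1 (q ^ 2 - q) - 1) ^ (q - 1)"
proof -
  have "q + (q ^ 2 - q) = q ^ 2" by (simp add: power2_eq_square)
  then have "monom 1 (q ^ 2) - monom 1 q = monom (1::'a) q * (monom 1 (q ^ 2 - q) - 1)"
    by (simp add: algebra_simps mult_monom)
  then show ?thesis by (simp add: power_mult_distrib monom_power)
qed

text \<open>The gap below the exponent q(q - 1) and the leading coefficient are what the comparison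
  of two charts exploits.\<close>

lemma coeff_power_diff_monom:
  shows "j < q * (q - 1) \<Longrightarrow> coeff ((monom (1::'a) (q ^ 2) - monom 1 q) ^ (q - 1)) j = 0"
    and "coeff ((monom (1::'a) (q ^ 2) - monom 1 q) ^ (q - 1)) (q ^ 2 * (q - 1)) = 1"
proof -
  show "j < q * (q - 1) \<Longrightarrow> coeff ((monom (1::'a) (q ^ 2) - monom 1 q) ^ (q - 1)) j = 0"
    unfolding power_diff_monom by (simp add: coeff_monom_mult)
  have "q < q ^ 2" using q_ge_2 by (simp add: power2_eq_square)
  then have "degree (monom (1::'a) (q ^ 2) - monom 1 q) = q ^ 2"
    by (simp add: degree_monom_eq degree_add_eq_left flip: add_uminus_conv_diff)
  moreover have "lead_coeff (monom (1::'a) (q ^ 2) - monom 1 q) = 1"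
    using calculation \<open>q < q ^ 2\<close> by simp
  ultimately show "coeff ((monom (1::'a) (q ^ 2) - monom 1 q) ^ (q - 1)) (q ^ 2 * (q - 1)) = 1"
    by (metis degree_power_eq lead_coeff_power leading_coeff_0_iff mult.commute power_one zero_neq_one)
qed

text \<open>Restrict F to Z = 0 in the charts Y = 1 and X = 1. The two restrictions f and g list the
  same coefficients in reverse order, and d < q^3 - q places the reversed leading term of f in the
  exponent gap of g, so it can only be the constant term.\<close>

proposition invariant_form_degree:
  assumes F: "perspectivity_invariant F" and form: "form_of_degree F d" and d: "d < q ^ 3 - q"
  shows "Poly_Mapping.lookup F (d, 0, 0) = 0 \<Longrightarrow> varZ dvd F"
    and "Poly_Mapping.lookup F (d, 0, 0) \<noteq> 0 \<Longrightarrow> d = 0 \<or> d = q ^ 3 - q ^ 2"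
proof -
  define f where "f = teval const1 F [:0, 1:] 1 0"
  define g where "g = teval const1 F 1 [:0, 1:] 0"
  define u where "u = (monom (1::'a) (q ^ 2) - monom 1 q) ^ (q - 1)"
  let ?F = "tsubst F varY varX varZ"
  have g_swap: "g = teval const1 ?F [:0, 1:] 1 0"
    by (simp add: g_def teval_tsubst[OF const1_hom] teval_simps[OF const1_hom])
  have "degree f \<le> d" unfolding f_def
    by (intro degree_le allI impI) (simp add: coeff_X10[OF form])
  then obtain \<alpha> \<beta> where f: "f = [:\<alpha>:] + smult \<beta> u"
    using invariant_restriction_to_line[OF F] d unfolding f_def u_def by (metis order_le_less_trans)
  have "degree g \<le> d" unfolding g_def
    by (intro degree_le allI impI) (simp add: coeff_1X0[OF form])
  then obtain \<alpha>' \<beta>' where g: "g = [:\<alpha>':] + smult \<beta>' u"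
    using invariant_restriction_to_line[OF perspectivity_invariant_swap[OF F]] d
    unfolding g_swap u_def by (metis order_le_less_trans)
  have q1: "0 < q * (q - 1)" using q_ge_2 by simp
  have u0: "poly u 0 = 0" unfolding u_def poly_0_coeff_0 by (rule coeff_power_diff_monom(1)[OF q1])
  note tr = perspectivity_translate[OF F comm_ring_hom_id Fq_1]
  have hp: "poly (teval const1 F x y z) a = teval (\<lambda>c. c) F (poly x a) (poly y a) (poly z a)" for x y z a
    using hom_teval[OF const1_hom poly_hom.comm_ring_hom_axioms, of F x y z a] by simp
  \<comment> \<open>Translations join (0, 1, 0) to (1, 0, 0) through (1, 1, 0), so the constants of
    the two charts agree.\<close>
  have "\<alpha> = teval (\<lambda>c. c) F 0 1 0"
    using arg_cong[OF f, of "\<lambda>f. poly f 0"] by (simp add: f_def hp u0)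
  also have "\<dots> = teval (\<lambda>c. c) F 1 1 0" using tr(2)[of 0 1 0] by simp
  also have "\<dots> = teval (\<lambda>c. c) F 1 0 0" using tr(3)[of 1 0 0] by simp
  also have eq: "\<dots> = \<alpha>'"
    using arg_cong[OF g, of "\<lambda>f. poly f 0"] by (simp add: g_def hp u0)
  finally have \<alpha>: "\<alpha> = \<alpha>'" .
  have lookup: "Poly_Mapping.lookup F (d, 0, 0) = \<alpha>'"
    using eq teval_unit_vectors(1)[OF form] by simp
  let ?i = "q ^ 2 * (q - 1)"
  have i: "?i = q ^ 3 - q ^ 2"
    by (simp add: power3_eq_cube power2_eq_square algebra_simps)
  have i_pos: "?i > 0" using q_ge_2 by simp
  have beta: "d = q ^ 3 - q ^ 2 \<and> \<alpha>' = \<beta>" if "\<beta> \<noteq> 0"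
  proof -
    have "coeff [:\<alpha>:] ?i = 0" using i_pos by (simp only: coeff_pCons split: nat.split) simp
    then have "coeff f ?i = \<beta>"
      by (simp only: f coeff_add coeff_smult u_def coeff_power_diff_monom(2)) simp
    then have le: "?i \<le> d" and lk: "Poly_Mapping.lookup F (?i, d - ?i, 0) = \<beta>"
      using that coeff_X10[OF form, of ?i] unfolding f_def by (auto split: if_splits)
    have "coeff g (d - ?i) = \<beta>"
      using le lk coeff_1X0[OF form, of "d - ?i"] unfolding g_def by simp
    moreover have "d - ?i < q * (q - 1)"
    proof -
      have "q ^ 3 - q = ?i + q * (q - 1)"
        using q_ge_2 by (simp add: power3_eq_cube power2_eq_square algebra_simps)
      then show ?thesis using d le by linarith
    qed
    then have "coeff u (d - ?i) = 0" unfolding u_def by (rule coeff_power_diff_monom(1))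
    ultimately have "coeff [:\<alpha>':] (d - ?i) = \<beta>" by (simp add: g)
    then show ?thesis using that le i by (auto simp: coeff_pCons split: nat.splits)
  qed
  show "varZ dvd F" if "Poly_Mapping.lookup F (d, 0, 0) = 0"
  proof (rule varZ_dvd_if_X10_eq_0[OF form])
    have "\<beta> = 0" using beta that lookup by auto
    then show "teval const1 F [:0, 1:] 1 0 = 0" using f \<alpha> that lookup by (simp add: f_def)
  qed
  show "d = 0 \<or> d = q ^ 3 - q ^ 2" if "Poly_Mapping.lookup F (d, 0, 0) \<noteq> 0"
  proof (cases "\<beta> = 0")
    case True
    have "coeff f d \<noteq> 0" using that coeff_X10[OF form, of d] by (simp add: f_def)
    then show ?thesis using True by (auto simp: f coeff_pCons split: nat.splits)
  qed (use beta in blast)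
qed

text \<open>The (q - 1)-st powers of q^2 distinct lines divide F, so its degree in Z is at least q^2
  (q - 1), hence at least d. Yet the coefficient of Z^d is F(0, 0, 1), which translations identify
  with F(1, 0, 0) = 0.\<close>

proposition no_invariant_form_divisible_by_Z:
  assumes F: "perspectivity_invariant F" and form: "form_of_degree F d" and d: "d \<le> q ^ 3 - q ^ 2"
    and Z: "varZ dvd F"
  shows False
proof -
  define P where "P = nested F"
  have Pnz: "P \<noteq> 0" using form_nonzero[OF form] by (simp add: P_def nested_eq_0_iff)
  have P_eq: "P = teval const3 F [:[:[:0, 1:]:]:] [:[:0, 1:]:] [:0, 1:]" by (simp add: P_def nested_def)
  have compose: "pcompose P r = teval const3 F [:[:[:0, 1:]:]:] [:[:0, 1:]:] r" for r
    unfolding P_eq hom_teval[OF const3_hom pcompose_hom.comm_ring_hom_axioms]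
    by (simp add: pcompose_pCons)
  have scale: "pcompose P [:0, [:[:c:]:]:] = P" if "c \<in> Fq - {0}" for c
    using perspectivity_scale(2)[OF F const3_hom that, of _ _ "[:0, 1:]"]
    unfolding compose by (simp add: P_eq)
  \<comment> \<open>The exponent 0 is excluded by divisibility by Z, the exponents strictly between
    0 and q - 1 by scaling.\<close>
  have "coeff P k = 0" if "k < q - 1" for k
  proof (cases "k = 0")
    case True
    then show ?thesis using Z unfolding varZ_dvd_iff
      by (auto simp: P_def poly_eq_iff coeff_nested)
  next
    case False
    then show ?thesis
      using scale_invariant_coeff[OF _ const2_hom scale, of k] that by (simp add: inj_def)
  qed
  then have "monom 1 (q - 1) dvd P" by (simp add: monom_1_dvd_iff')
  then obtain P1 where P1: "P = monom 1 (q - 1) * P1" by (rule dvdE)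
  \<comment> \<open>The elements are the linear forms aX + bY, which will be roots in the outer
    variable Z.\<close>
  define S where "S = (\<lambda>(a, b). [:[:0, a:], [:b:]:]) ` (Fq \<times> Fq)"
  have translate: "pcompose P [:[:[:0, a:], [:b:]:], 1:] = P" if "a \<in> Fq" "b \<in> Fq" for a b
  proof -
    have "[:[:[:0, a:], [:b:]:], 1:] = [:0, 1:] + const3 b * [:[:0, 1:]:] + const3 a * [:[:[:0, 1:]:]:]"
      by (simp add: pCons_one)
    then have "pcompose P [:[:[:0, a:], [:b:]:], 1:] =
        teval const3 F [:[:[:0, 1:]:]:] [:[:0, 1:]:] [:0, 1:]"
      by (simp only: compose perspectivity_translate(4)[OF F const3_hom that(2)]
        perspectivity_translate(5)[OF F const3_hom that(1)])
    then show ?thesis by (simp only: P_eq)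
  qed
  have order: "q - 1 \<le> order v P" if "v \<in> S" for v
  proof -
    from that obtain a b where ab: "a \<in> Fq" "b \<in> Fq" and v: "v = [:[:0, a:], [:b:]:]"
      by (auto simp: S_def)
    \<comment> \<open>Translating by -v carries the divisor Z^(q - 1) to (Z - v)^(q - 1).\<close>
    have "P = pcompose P [:- v, 1:]"
      using translate[OF Fq_uminus[OF ab(1)] Fq_uminus[OF ab(2)]] by (simp add: v)
    also have "\<dots> = [:- v, 1:] ^ (q - 1) * pcompose P1 [:- v, 1:]"
      by (simp add: P1 pcompose_mult pcompose_monom_1)
    finally have "[:- v, 1:] ^ (q - 1) dvd P" by (metis dvd_triv_left)
    then show ?thesis using Pnz by (simp add: order_divides)
  qed
  have "card S = q ^ 2"
    unfolding S_def by (subst card_image) (auto simp: inj_on_def card_Fq card_cartesian_product power2_eq_square)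
  moreover have finS: "finite S" using finite_Fq by (simp add: S_def)
  moreover have "card S * (q - 1) \<le> (\<Sum>v\<in>S. order v P)"
    using sum_bounded_below[of S "q - 1" "\<lambda>v. order v P"] order by simp
  moreover have "(\<Sum>v\<in>S. order v P) \<le> (\<Sum>v | poly P v = 0. order v P)"
  proof (rule sum_mono2)
    show "S \<subseteq> {v. poly P v = 0}"
      using order q_ge_2 Pnz by (force simp: order_root)
  qed (use poly_roots_finite[OF Pnz] in auto)
  moreover have "\<dots> \<le> degree P" by (rule sum_order_le_degree[OF Pnz])
  moreover have "q ^ 2 * (q - 1) = q ^ 3 - q ^ 2"
    by (simp add: power3_eq_cube power2_eq_square algebra_simps)
  ultimately have "d \<le> degree P" using d by simp
  moreover have "coeff P k = 0" if "k \<ge> d" for k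
  proof -
    note tr = perspectivity_translate[OF F comm_ring_hom_id Fq_1]
    have "Poly_Mapping.lookup F (0, 0, d) = teval (\<lambda>c. c) F 0 0 1"
      using teval_unit_vectors(2)[OF form] by simp
    also have "\<dots> = teval (\<lambda>c. c) F 1 0 1" using tr(1)[of 0 1 0] by simp
    also have "\<dots> = teval (\<lambda>c. c) F 1 0 0" using tr(5)[of 1 0 0] by simp
    also have "\<dots> = Poly_Mapping.lookup F (d, 0, 0)" by (rule teval_unit_vectors(1)[OF form])
    also have "\<dots> = 0" using Z by (simp add: varZ_dvd_iff)
    finally have "Poly_Mapping.lookup F (i, j, k) = 0" for i j
      using that form_lookup_eq_0[OF form, of i j k] by (cases "i + j + k = d") auto
    then show ?thesis by (simp add: poly_eq_iff P_def coeff_nested)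
  qed
  ultimately have "lead_coeff P = 0" by blast
  then show False using Pnz by simp
qed

text \<open>Invariant forms of this degree do not vanish at (1, 0, 0), since otherwise Z divides
  them. Subtracting the multiple that cancels the value there leaves an invariant form vanishing at
  this point, which must be 0.\<close>

proposition invariant_form_unique:
  assumes "perspectivity_invariant F" "form_of_degree F (q ^ 3 - q ^ 2)"
    and "perspectivity_invariant G" "form_of_degree G (q ^ 3 - q ^ 2)"
  shows "\<exists>t. t \<noteq> 0 \<and> F = tconst t * G"
proof -
  let ?d = "q ^ 3 - q ^ 2"
  have dlt: "?d < q ^ 3 - q"
    using q_ge_2 power_strict_increasing[of 1 2 q] power_strict_increasing[of 1 3 q]
    by (intro diff_less_mono2) simp_all
  have nz: "Poly_Mapping.lookup F (?d, 0, 0) \<noteq> 0"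
    if "perspectivity_invariant F" "form_of_degree F ?d" for F :: "'a tpoly"
    using invariant_form_degree(1)[OF that dlt] no_invariant_form_divisible_by_Z[OF that] by blast
  define t where "t = Poly_Mapping.lookup F (?d, 0, 0) / Poly_Mapping.lookup G (?d, 0, 0)"
  define D where "D = F - tconst t * G"
  have lookup_D: "Poly_Mapping.lookup D m = Poly_Mapping.lookup F m - t * Poly_Mapping.lookup G m" for m
  proof (cases m)
    case (fields i j k)
    have "nested (tconst t * G) = const3 t * nested G"
      by (simp only: nested_mult) (simp only: nested_def teval_tconst[OF const3_hom])
    then have "Poly_Mapping.lookup (tconst t * G) m = t * Poly_Mapping.lookup G m"
      by (simp add: fields coeff_nested[symmetric])
    then show ?thesis by (simp add: D_def lookup_minus)
  qed
  have "D = 0"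
  proof (rule ccontr)
    assume "D \<noteq> 0"
    then have form: "form_of_degree D ?d"
      unfolding form_iff_lookup
      using form_lookup_eq_0[OF assms(2)] form_lookup_eq_0[OF assms(4)]
      by (metis diff_zero lookup_D mult_zero_right)
    have inv: "perspectivity_invariant D"
      unfolding D_def using assms by (intro perspectivity_invariant_diff)
    have "Poly_Mapping.lookup D (?d, 0, 0) = 0"
      using nz[OF assms(3,4)] by (simp add: lookup_D t_def)
    then show False using nz[OF inv form] by blast
  qed
  moreover have "t \<noteq> 0" using nz[OF assms(1,2)] nz[OF assms(3,4)] by (simp add: t_def)
  ultimately show ?thesis by (auto simp: D_def)
qed

end

section \<open>The DGZ form\<close>

definition moore2 :: "nat \<Rightarrow> 'b::comm_ring_1 \<Rightarrow> 'b \<Rightarrow> 'b" where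
  "moore2 q x y = x * y ^ q - x ^ q * y"

text \<open>The Dickson invariant of GL(2,q) of degree q^2 - q, that is, the quotient of x y^(q^2) -
  x^(q^2) y by \<open>moore2\<close>. As a geometric sum it makes sense in every commutative ring,
  without division.\<close>

definition dickson2 :: "nat \<Rightarrow> 'b::comm_ring_1 \<Rightarrow> 'b \<Rightarrow> 'b" where
  "dickson2 q x y = (\<Sum>j\<le>q. (x ^ (q - 1)) ^ j * (y ^ (q - 1)) ^ (q - j))"

text \<open>Over K this is the expanded product of z - ax - by over all a, b in the subfield of
  order q.\<close>

definition span_poly :: "nat \<Rightarrow> 'b::comm_ring_1 \<Rightarrow> 'b \<Rightarrow> 'b \<Rightarrow> 'b" where
  "span_poly q x y z = z ^ (q ^ 2) - dickson2 q x y * z ^ q + moore2 q x y ^ (q - 1) * z"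

text \<open>Dickson's recursion from two to three variables; it gives the invariant of GL(3,q) of
  degree q^3 - q^2 as an explicit polynomial instead of a quotient.\<close>

definition dgz :: "nat \<Rightarrow> 'b::comm_ring_1 \<Rightarrow> 'b \<Rightarrow> 'b \<Rightarrow> 'b" where
  "dgz q x y z = dickson2 q x y ^ q + span_poly q x y z ^ (q - 1)"

definition moore3 :: "nat \<Rightarrow> nat \<Rightarrow> 'b::comm_ring_1 \<Rightarrow> 'b \<Rightarrow> 'b \<Rightarrow> 'b" where
  "moore3 q e x y z = x * (y ^ e * z ^ q - z ^ e * y ^ q) - y * (x ^ e * z ^ q - z ^ e * x ^ q)
     + z * (x ^ e * y ^ q - y ^ e * x ^ q)"

lemma moore_eq_moore3: "moore q e = moore3 q e varX varY varZ"
  by (simp add: moore_def moore3_def)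

context comm_ring_hom begin

lemma hom_moore2: "hom (moore2 q x y) = moore2 q (hom x) (hom y)"
  by (simp add: moore2_def hom_minus hom_mult hom_power)

lemma hom_dickson2: "hom (dickson2 q x y) = dickson2 q (hom x) (hom y)"
  by (simp add: dickson2_def hom_sum hom_mult hom_power)

lemma hom_span_poly: "hom (span_poly q x y z) = span_poly q (hom x) (hom y) (hom z)"
  by (simp add: span_poly_def hom_minus hom_add hom_mult hom_power hom_moore2 hom_dickson2)

lemma hom_dgz: "hom (dgz q x y z) = dgz q (hom x) (hom y) (hom z)"
  by (simp add: dgz_def hom_add hom_power hom_dickson2 hom_span_poly)

lemma hom_moore3: "hom (moore3 q e x y z) = moore3 q e (hom x) (hom y) (hom z)"
  by (simp add: moore3_def hom_minus hom_add hom_mult hom_power)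

end

text \<open>Multiplicativity of the 3 x 3 determinant written out, for one matrix acting on three
  rows.\<close>

lemma det_identity:
  fixes x y z :: "'b::comm_ring_1"
  shows "(a1 * x + b1 * y + c1 * z) * ((a2 * x' + b2 * y' + c2 * z') * (a3 * x'' + b3 * y'' + c3 * z'')
        - (a3 * x' + b3 * y' + c3 * z') * (a2 * x'' + b2 * y'' + c2 * z''))
      - (a2 * x + b2 * y + c2 * z) * ((a1 * x' + b1 * y' + c1 * z') * (a3 * x'' + b3 * y'' + c3 * z'')
        - (a3 * x' + b3 * y' + c3 * z') * (a1 * x'' + b1 * y'' + c1 * z''))
      + (a3 * x + b3 * y + c3 * z) * ((a1 * x' + b1 * y' + c1 * z') * (a2 * x'' + b2 * y'' + c2 * z'')
        - (a2 * x' + b2 * y' + c2 * z') * (a1 * x'' + b1 * y'' + c1 * z''))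
    = (a1 * b2 * c3 + b1 * c2 * a3 + c1 * a2 * b3 - a1 * c2 * b3 - b1 * a2 * c3 - c1 * b2 * a3) *
      (x * (y' * z'' - z' * y'') - y * (x' * z'' - z' * x'') + z * (x' * y'' - y' * x''))"
  by (simp add: algebra_simps)

lemma tpoly_power_nonzero: "F \<noteq> 0 \<Longrightarrow> F ^ n \<noteq> 0" for F :: "'a::field tpoly"
  by (induction n) (simp_all add: tpoly_mult_eq_0)

section \<open>Dickson's identities for Moore determinants\<close>

context finite_subfield begin

text \<open>With u = x^(q-1) and v = y^(q-1) this is xy times the geometric sum identity for v^(q+1)
  - u^(q+1).\<close>

lemma dickson2_mult_moore2:
  fixes x y :: "'b::comm_ring_1"
  shows "dickson2 q x y * moore2 q x y = x * y ^ (q ^ 2) - x ^ (q ^ 2) * y"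
proof -
  define u v where "u = x ^ (q - 1)" and "v = y ^ (q - 1)"
  have q: "Suc (q - 1) = q" "Suc ((q - 1) * (q + 1)) = q ^ 2"
    using q_pos by (simp_all add: power2_eq_square algebra_simps) 
  have xq: "x ^ q = x * u" "y ^ q = y * v"
    using q(1) by (simp_all add: u_def v_def flip: power_Suc)
  have xq2: "x ^ (q ^ 2) = x * u ^ (q + 1)" "y ^ (q ^ 2) = y * v ^ (q + 1)"
    using q(2) by (simp_all add: u_def v_def flip: power_Suc power_mult)
  have "v ^ Suc q - u ^ Suc q = (v - u) * (\<Sum>i<Suc q. u ^ (Suc q - Suc i) * v ^ i)"
    by (rule power_diff_sumr2)
  also have "(\<Sum>i<Suc q. u ^ (Suc q - Suc i) * v ^ i) = (\<Sum>j\<le>q. u ^ j * v ^ (q - j))"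
    by (rule sum.reindex_bij_witness[of _ "\<lambda>j. q - j" "\<lambda>j. q - j"]) auto
  also have "\<dots> = dickson2 q x y" by (simp add: dickson2_def u_def v_def)
  finally have "dickson2 q x y * (v - u) = v ^ (q + 1) - u ^ (q + 1)" by (simp add: mult.commute)
  then have "x * y * (dickson2 q x y * (v - u)) = x * y * (v ^ (q + 1) - u ^ (q + 1))" by simp
  then show ?thesis unfolding moore2_def xq xq2 by (simp add: algebra_simps)
qed

lemma power_q_2: "x ^ (q ^ 2) = (x ^ q) ^ q" and power_q_3: "x ^ (q ^ 3) = ((x ^ q) ^ q) ^ q"
  for x :: "'b::comm_ring_1"
  by (simp_all add: power2_eq_square power3_eq_cube flip: power_mult)

lemma moore2_power_q:
  fixes x y :: "'b::comm_ring_1"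
  assumes "of_nat p = (0::'b)"
  shows "moore2 q x y ^ q = x ^ q * y ^ (q ^ 2) - x ^ (q ^ 2) * y ^ q"
  by (simp add: moore2_def frobenius_diff[OF assms] power_mult_distrib power_q_2)

text \<open>Up to sign, and after Frobenius has expanded the last coefficient, the right side is the
  Moore determinant expanded along its z entries.\<close>

lemma moore2_mult_span_poly:
  fixes x y :: "'b::comm_ring_1"
  shows "moore2 q x y * span_poly q x y z =
     moore2 q x y * z ^ (q ^ 2) - (x * y ^ (q ^ 2) - x ^ (q ^ 2) * y) * z ^ q + moore2 q x y ^ q * z"
proof -
  have "moore2 q x y * moore2 q x y ^ (q - 1) = moore2 q x y ^ q"
    using q_pos by (cases q) simp_all
  then show ?thesis
    unfolding dickson2_mult_moore2[symmetric] span_poly_def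
    by (simp add: algebra_simps)
qed

lemma moore3_q2:
  fixes x y :: "'b::comm_ring_1"
  assumes "of_nat p = (0::'b)"
  shows "moore3 q (q ^ 2) x y z = - (moore2 q x y * span_poly q x y z)"
  unfolding moore2_mult_span_poly moore2_power_q[OF assms]
  by (simp add: moore3_def moore2_def algebra_simps)

text \<open>Both sides become combinations of z^(q^3), z^(q^2), z^q and z: on the right via V^(q-1)
  V = V^q and Frobenius, and there the z^(q^2) terms cancel. The assumption \<open>cancel\<close>
  provides the single division needed, by a power of \<open>moore2\<close>.\<close>

lemma moore3_q3:
  fixes x y :: "'b::comm_ring_1"
  assumes p0: "of_nat p = (0::'b)"
    and cancel: "\<And>A B. A * moore2 q x y ^ q = B * moore2 q x y ^ q \<Longrightarrow> A = B"
  shows "moore3 q (q ^ 3) x y z = dgz q x y z * moore3 q (q ^ 2) x y z"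
proof -
  define l c V where "l = moore2 q x y" and "c = dickson2 q x y" and "V = span_poly q x y z"
  define m where "m = x * y ^ (q ^ 2) - x ^ (q ^ 2) * y"
  have cl: "c * l = m" unfolding c_def l_def m_def by (rule dickson2_mult_moore2)
  have mq: "m ^ q = x ^ q * y ^ (q ^ 3) - x ^ (q ^ 3) * y ^ q"
    by (simp add: m_def frobenius_diff[OF p0] power_mult_distrib power_q_2 power_q_3)
  have lq: "l ^ q = x ^ q * y ^ (q ^ 2) - x ^ (q ^ 2) * y ^ q"
    unfolding l_def by (rule moore2_power_q[OF p0])
  have lq2: "l ^ (q ^ 2) = x ^ (q ^ 2) * y ^ (q ^ 3) - x ^ (q ^ 3) * y ^ (q ^ 2)"
    by (simp add: power_q_2[of l] lq frobenius_diff[OF p0] power_mult_distrib power_q_2 power_q_3)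
  have lql: "(l ^ (q - 1)) ^ q * l ^ q = l ^ (q ^ 2)"
  proof -
    have "l ^ (q - 1) * l = l ^ q" using q_pos by (cases q) simp_all
    then show ?thesis by (metis power_mult_distrib power_q_2)
  qed
  \<comment> \<open>After multiplication by \<open>l ^ q\<close> this is the Pluecker relation between the 2x2 minors
    of the matrix with rows \<open>x ^ (q ^ i), y ^ (q ^ i)\<close> for \<open>i \<le> 3\<close>.\<close>
  have "l * (l ^ (q - 1)) ^ q - c ^ q * m = - (x * y ^ (q ^ 3) - x ^ (q ^ 3) * y)"
  proof (rule cancel, fold l_def)
    have "(l * (l ^ (q - 1)) ^ q - c ^ q * m) * l ^ q
        = l * ((l ^ (q - 1)) ^ q * l ^ q) - (c * l) ^ q * m"
      by (simp add: algebra_simps power_mult_distrib)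
    also have "\<dots> = l * l ^ (q ^ 2) - m ^ q * m" by (simp only: lql cl)
    also have "\<dots> = - (x * y ^ (q ^ 3) - x ^ (q ^ 3) * y) * l ^ q"
      unfolding mq lq lq2 by (simp add: l_def moore2_def m_def algebra_simps)
    finally show "(l * (l ^ (q - 1)) ^ q - c ^ q * m) * l ^ q
      = - (x * y ^ (q ^ 3) - x ^ (q ^ 3) * y) * l ^ q" .
  qed
  then have e: "l * (l ^ (q - 1)) ^ q = c ^ q * m - (x * y ^ (q ^ 3) - x ^ (q ^ 3) * y)"
    by (simp add: algebra_simps)
  have lV: "l * V = l * z ^ (q ^ 2) - m * z ^ q + l ^ q * z"
    unfolding l_def V_def m_def by (rule moore2_mult_span_poly)
  have "V ^ q = z ^ (q ^ 3) - c ^ q * z ^ (q ^ 2) + (l ^ (q - 1)) ^ q * z ^ q"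
    by (simp add: V_def span_poly_def frobenius_diff[OF p0] frobenius_add[OF p0] power_mult_distrib
        power_q_2 power_q_3 flip: c_def l_def)
  then have lVq: "l * V ^ q = l * z ^ (q ^ 3) - c ^ q * (l * z ^ (q ^ 2)) + (l * (l ^ (q - 1)) ^ q) * z ^ q"
    by (simp only:) (simp add: algebra_simps)
  have Vq: "V ^ (q - 1) * V = V ^ q" using q_pos by (cases q) simp_all
  have "dgz q x y z * moore3 q (q ^ 2) x y z = - (l * (V ^ (q - 1) * V) + c ^ q * (l * V))"
    unfolding moore3_q2[OF p0] dgz_def
    by (simp add: algebra_simps flip: l_def V_def c_def)
  also have "\<dots> = - (l * z ^ (q ^ 3) - (x * y ^ (q ^ 3) - x ^ (q ^ 3) * y) * z ^ q + (c * l) ^ q * z)"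
    unfolding Vq lVq lV e by (simp add: algebra_simps power_mult_distrib)
  also have "\<dots> = moore3 q (q ^ 3) x y z"
    unfolding cl mq by (simp add: moore3_def l_def moore2_def algebra_simps)
  finally show ?thesis ..
qed

definition dgz_form :: "'a tpoly" where
  "dgz_form = dgz q varX varY varZ"

lemma teval_dgz_form: "comm_ring_hom h \<Longrightarrow> teval h dgz_form x y z = dgz q x y z"
  unfolding dgz_form_def by (simp add: comm_ring_hom.hom_dgz[OF teval_hom] teval_var)

lemma moore2_var_nonzero: "moore2 q varX varY \<noteq> (0 :: 'a tpoly)"
proof
  assume "moore2 q varX varY = (0 :: 'a tpoly)"
  then have "teval const1 (moore2 q varX varY) 1 [:0, 1::'a:] 0 = 0" by (simp add: teval_0[OF const1_hom])
  then have "moore2 q 1 [:0, 1::'a:] = 0"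
    by (simp add: comm_ring_hom.hom_moore2[OF teval_hom[OF const1_hom]] teval_var[OF const1_hom])
  then have "monom 1 q - [:0, 1::'a:] = 0" by (simp add: moore2_def X_power)
  then show False using degree_additive by simp
qed

lemma dickson2_0_1: "dickson2 q 0 1 = (1::'b::comm_ring_1)"
  and dickson2_1_0: "dickson2 q 1 0 = (1::'b::comm_ring_1)"
proof -
  have "(0::'b) ^ (q - 1) = 0" using q_ge_2 by (simp add: power_0_left)
  then have e: "dickson2 q 0 1 = (\<Sum>j\<le>q. 0 ^ j :: 'b)" "dickson2 q 1 0 = (\<Sum>j\<le>q. 0 ^ (q - j) :: 'b)"
    by (simp_all add: dickson2_def)
  have "(\<Sum>j\<le>q. 0 ^ j :: 'b) = (\<Sum>j\<le>q. if j = 0 then 1 else 0)"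
    "(\<Sum>j\<le>q. 0 ^ (q - j) :: 'b) = (\<Sum>j\<le>q. if j = q then 1 else 0)"
    by (intro sum.cong; simp add: power_0_left)+
  then show "dickson2 q 0 1 = (1::'b)" "dickson2 q 1 0 = (1::'b)"
    unfolding e by simp_all
qed

lemma span_poly_var_nonzero: "span_poly q varX varY varZ \<noteq> (0 :: 'a tpoly)"
proof
  assume "span_poly q varX varY varZ = (0 :: 'a tpoly)"
  then have "teval const1 (span_poly q varX varY varZ) 0 1 [:0, 1::'a:] = 0"
    by (simp add: teval_0[OF const1_hom])
  then have "span_poly q 0 1 [:0, 1::'a:] = 0"
    by (simp add: comm_ring_hom.hom_span_poly[OF teval_hom[OF const1_hom]] teval_var[OF const1_hom])
  then have "monom 1 (q ^ 2) = monom (1::'a) q"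
    using q_ge_2 by (simp add: span_poly_def dickson2_0_1 moore2_def power_0_left X_power)
  then have "q ^ 2 = q" by (metis degree_monom_eq zero_neq_one)
  then show False using q_ge_2 by (simp add: power2_eq_square)
qed

lemma moore_q2_nonzero: "moore q (q ^ 2) \<noteq> (0 :: 'a tpoly)"
  unfolding moore_eq_moore3 moore3_q2[OF of_nat_p_tpoly]
  using moore2_var_nonzero span_poly_var_nonzero by (simp add: tpoly_mult_eq_0)

proposition dgz_form_mult_moore: "dgz_form * moore q (q ^ 2) = moore q (q ^ 3)"
  unfolding moore_eq_moore3 dgz_form_def
  by (rule moore3_q3[OF of_nat_p_tpoly, symmetric])
     (erule tpoly_mult_cancel, intro tpoly_power_nonzero moore2_var_nonzero)

lemma is_DGZ_iff: "is_DGZ q F \<longleftrightarrow> (\<exists>t. t \<noteq> 0 \<and> F = tconst t * dgz_form)"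
proof
  assume "is_DGZ q F"
  then obtain c where c: "c \<noteq> 0" "tconst c * F * moore q (q ^ 2) = dgz_form * moore q (q ^ 2)"
    by (auto simp: is_DGZ_def dgz_form_mult_moore)
  then have "tconst c * F = dgz_form" using moore_q2_nonzero by (blast intro: tpoly_mult_cancel)
  then have "tconst (inverse c) * dgz_form = tconst (inverse c * c) * F"
    unfolding tconst_mult mult.assoc by simp
  then have "F = tconst (inverse c) * dgz_form"
    using c(1) by (simp add: tconst_1)
  then show "\<exists>t. t \<noteq> 0 \<and> F = tconst t * dgz_form" using c(1) by (metis inverse_nonzero_iff_nonzero)
next
  assume "\<exists>t. t \<noteq> 0 \<and> F = tconst t * dgz_form"
  then obtain t where t: "t \<noteq> 0" "F = tconst t * dgz_form" by blast
  have "tconst (inverse t) * F = tconst (inverse t * t) * dgz_form"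
    unfolding t(2) tconst_mult mult.assoc ..
  then have "tconst (inverse t) * F = dgz_form"
    using t(1) by (simp add: tconst_1)
  then show "is_DGZ q F" unfolding is_DGZ_def
    using t(1) by (intro exI[of _ "inverse t"]) (simp add: dgz_form_mult_moore)
qed

section \<open>GL(3,q)-invariance and homogeneity of the DGZ form\<close>

lemma linear_form_power:
  fixes x y z :: "'b::comm_ring_1"
  assumes "of_nat p = (0::'b)" "\<alpha> ^ q = \<alpha>" "\<beta> ^ q = \<beta>" "\<gamma> ^ q = \<gamma>"
  shows "(\<alpha> * x + \<beta> * y + \<gamma> * z) ^ (q ^ k) = \<alpha> * x ^ (q ^ k) + \<beta> * y ^ (q ^ k) + \<gamma> * z ^ (q ^ k)"
proof (induction k)
  case (Suc k)
  have "w ^ (q ^ Suc k) = (w ^ (q ^ k)) ^ q" for w :: 'b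
    by (simp add: mult.commute flip: power_mult)
  then show ?case
    using Suc assms by (simp add: frobenius_add[OF assms(1)] power_mult_distrib)
qed simp

text \<open>The matrix entries are fixed by Frobenius, so every row of the Moore matrix, a power of
  the coordinate row, is transformed by the same matrix.\<close>

lemma transform_moore:
  fixes A :: "'a ^ 3 ^ 3"
  assumes A: "A \<in> GL3q q"
  shows "transform (moore q (q ^ k)) A = tconst (det A) * moore q (q ^ k)"
proof -
  interpret t: comm_ring_hom "tconst :: 'a \<Rightarrow> _" by (rule tconst_hom)
  have Aq: "tconst (A $ i $ j) ^ q = tconst (A $ i $ j)" for i j
  proof -
    have "A $ i $ j ^ q = A $ i $ j" using A by (simp add: GL3q_def)
    then show ?thesis by (simp only: tconst_power[symmetric])
  qed
  have pow: "lin_form A i ^ (q ^ m) =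
      tconst (A $ i $ 1) * varX ^ (q ^ m) + tconst (A $ i $ 2) * varY ^ (q ^ m) + tconst (A $ i $ 3) * varZ ^ (q ^ m)"
    for i m unfolding lin_form_def by (rule linear_form_power[OF of_nat_p_tpoly Aq Aq Aq])
  have "transform (moore q (q ^ k)) A = moore3 q (q ^ k) (lin_form A 1) (lin_form A 2) (lin_form A 3)"
    unfolding transform_def tsubst_eq_teval moore_eq_moore3
    by (simp add: comm_ring_hom.hom_moore3[OF teval_hom[OF tconst_hom]] teval_var[OF tconst_hom])
  also have "\<dots> = tconst (det A) * moore q (q ^ k)"
    unfolding moore3_def moore_def pow pow[of _ 1, unfolded power_one_right]
    unfolding lin_form_def det_identity
    by (simp add: det_3 t.hom_add t.hom_mult t.hom_minus)
  finally show ?thesis .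
qed

text \<open>Numerator and denominator acquire the same factor det A, which cancels in the quotient;
  hence equality and not merely proportionality.\<close>

proposition dgz_form_transform:
  assumes A: "A \<in> GL3q q"
  shows "transform dgz_form A = dgz_form"
proof -
  have dnz: "tconst (det A) \<noteq> 0"
    using A by (simp add: GL3q_def tconst_eq_0_iff)
  have "transform (dgz_form * moore q (q ^ 2)) A = transform dgz_form A * transform (moore q (q ^ 2)) A"
    by (simp add: transform_def tsubst_eq_teval teval_mult[OF tconst_hom])
  then have "tconst (det A) * (dgz_form * moore q (q ^ 2)) = transform dgz_form A * (tconst (det A) * moore q (q ^ 2))"
    by (simp only: transform_moore[OF A] dgz_form_mult_moore)
  then have "transform dgz_form A * (tconst (det A) * moore q (q ^ 2)) = dgz_form * (tconst (det A) * moore q (q ^ 2))"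
    by (simp only: mult_ac)
  moreover have "tconst (det A) * moore q (q ^ 2) \<noteq> 0"
    using dnz moore_q2_nonzero by (simp add: tpoly_mult_eq_0)
  ultimately show ?thesis by (rule tpoly_mult_cancel)
qed

lemma dgz_homogeneous:
  fixes x y z t :: "'b::comm_ring_1"
  shows "dgz q (t * x) (t * y) (t * z) = t ^ (q ^ 2 * (q - 1)) * dgz q x y z"
proof -
  have q: "q * (q - 1) + q = q ^ 2" "(q + 1) * (q - 1) + 1 = q ^ 2"
    using q_pos by (simp_all add: power2_eq_square algebra_simps)
  have c: "dickson2 q (t * x) (t * y) = t ^ (q * (q - 1)) * dickson2 q x y"
  proof -
    have "((t * x) ^ (q - 1)) ^ j * ((t * y) ^ (q - 1)) ^ (q - j)
        = t ^ (q * (q - 1)) * ((x ^ (q - 1)) ^ j * (y ^ (q - 1)) ^ (q - j))" if "j \<le> q" for j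
    proof -
      have "(q - 1) * j + (q - 1) * (q - j) = q * (q - 1)"
        using that add_mult_distrib2[of "q - 1" j "q - j"] by (simp add: mult.commute)
      then have "t ^ (q * (q - 1)) = (t ^ (q - 1)) ^ j * (t ^ (q - 1)) ^ (q - j)"
        by (simp only: power_mult[symmetric] power_add[symmetric])
      then show ?thesis by (simp only: power_mult_distrib mult_ac)
    qed
    then show ?thesis by (simp add: dickson2_def sum_distrib_left)
  qed
  have l: "moore2 q (t * x) (t * y) = t ^ (q + 1) * moore2 q x y"
    by (simp add: moore2_def power_mult_distrib algebra_simps)
  have e: "t ^ (q ^ 2) = t ^ (q * (q - 1)) * t ^ q" "t ^ (q ^ 2) = (t ^ (q + 1)) ^ (q - 1) * t"
    using q by (metis power_add, metis power_add power_mult power_one_right)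
  have "t ^ (q * (q - 1)) * dickson2 q x y * (t ^ q * z ^ q) = t ^ (q ^ 2) * (dickson2 q x y * z ^ q)"
    unfolding e(1) by (simp only: mult_ac)
  moreover have "(t ^ (q + 1)) ^ (q - 1) * moore2 q x y ^ (q - 1) * (t * z) = t ^ (q ^ 2) * (moore2 q x y ^ (q - 1) * z)"
    unfolding e(2) by (simp only: mult_ac)
  ultimately have V: "span_poly q (t * x) (t * y) (t * z) = t ^ (q ^ 2) * span_poly q x y z"
    unfolding span_poly_def c l power_mult_distrib by (simp only: distrib_left right_diff_distrib)
  have "(t ^ (q * (q - 1))) ^ q = t ^ (q ^ 2 * (q - 1))" "(t ^ (q ^ 2)) ^ (q - 1) = t ^ (q ^ 2 * (q - 1))"
    by (simp_all add: power2_eq_square mult_ac flip: power_mult)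
  then show ?thesis
    by (simp add: dgz_def c V power_mult_distrib distrib_left)
qed

lemma dgz_on_Z: "dgz q x y 0 = dickson2 q x y ^ q" for x y :: "'b::comm_ring_1"
  using q_ge_2 by (simp add: dgz_def span_poly_def power_0_left)

text \<open>\<open>graded\<close> yields the DGZ formula at (tX, tY, tZ), from which homogeneity
  extracts one power of t. The value 1 at (1, 0, 0) shows that the form is nonzero.\<close>

lemma form_dgz_form: "form_of_degree dgz_form (q ^ 3 - q ^ 2)"
proof -
  let ?N = "q ^ 2 * (q - 1)"
  let ?x = "[:[:[:0, 1::'a:]:]:]" and ?y = "[:[:0, 1::'a poly:]:]" and ?z = "[:0, 1::'a poly poly:]"
  have m: "monom r 1 = monom 1 1 * [:r:]" for r :: "'a poly poly poly" by (simp add: smult_monom mult.commute)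
  have "graded dgz_form = monom 1 1 ^ ?N * dgz q [:?x:] [:?y:] [:?z:]"
    unfolding graded_def teval_dgz_form[OF const4_hom] m[of ?x] m[of ?y] m[of ?z] dgz_homogeneous ..
  also have "\<dots> = monom 1 ?N * [:dgz q ?x ?y ?z:]"
    by (simp only: comm_ring_hom.hom_dgz[OF const1_hom] monom_power) simp
  also have "\<dots> = monom (dgz q ?x ?y ?z) ?N" by (simp add: smult_monom mult.commute)
  finally have "graded dgz_form = monom (coeff (graded dgz_form) ?N) ?N" by simp
  moreover have "dgz_form \<noteq> 0"
  proof
    assume "dgz_form = 0"
    then have "teval (\<lambda>c. c) dgz_form 1 0 0 = 0" by (simp add: teval_0[OF comm_ring_hom_id])
    then show False
      by (simp add: teval_dgz_form[OF comm_ring_hom_id] dgz_on_Z dickson2_1_0)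
  qed
  moreover have "?N = q ^ 3 - q ^ 2"
    by (simp add: power3_eq_cube power2_eq_square algebra_simps)
  ultimately show ?thesis by (metis form_iff_graded)
qed

end

section \<open>Irreducibility of the DGZ form\<close>

lemma order_0_power: "p \<noteq> 0 \<Longrightarrow> order 0 (p ^ n) = n * order 0 p" for p :: "'a::idom poly"
  by (induction n) (simp_all add: order_mult)

lemma order_0_pcompose_monom:
  fixes p :: "'a::idom poly"
  assumes "p \<noteq> 0" "k > 0"
  shows "order 0 (pcompose p (monom 1 k)) = k * order 0 p" "pcompose p (monom 1 k) \<noteq> 0"
proof -
  obtain r where r: "p = [:- 0, 1:] ^ order 0 p * r" "\<not> [:- 0, 1:] dvd r"
    using order_decomp[OF assms(1)] by blast
  have r0: "poly r 0 \<noteq> 0" using r(2) poly_eq_0_iff_dvd[of r 0] by simp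
  have "p = monom 1 (order 0 p) * r" using r(1) by (simp add: monom_altdef)
  then have "pcompose p (monom 1 k) = pcompose (monom 1 (order 0 p)) (monom 1 k) * pcompose r (monom 1 k)"
    by (metis pcompose_mult)
  then have e: "pcompose p (monom 1 k) = monom 1 (k * order 0 p) * pcompose r (monom 1 k)"
    by (simp add: pcompose_monom_1 monom_power)
  have "poly (pcompose r (monom 1 k)) 0 \<noteq> 0"
    using r0 assms(2) by (simp add: poly_pcompose poly_monom power_0_left)
  then have o: "order 0 (pcompose r (monom 1 k)) = 0" "pcompose r (monom 1 k) \<noteq> 0"
    by (auto intro: order_0I)
  then show "pcompose p (monom 1 k) \<noteq> 0" unfolding e by simp
  then show "order 0 (pcompose p (monom 1 k)) = k * order 0 p"
    unfolding e by (simp add: order_mult o)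
qed

lemma le_order_0_if_monom_dvd: "p \<noteq> 0 \<Longrightarrow> monom 1 n dvd p \<Longrightarrow> n \<le> order 0 p" for p :: "'a::idom poly"
  by (simp add: monom_1_dvd_iff)

lemma monom_order_0_dvd: "monom 1 (order 0 p) dvd p" for p :: "'a::idom poly"
  by (cases "p = 0") (simp_all add: monom_1_dvd_iff)

text \<open>Rotation permutes the three coordinate axes cyclically, so that statements about the
  axis Z = 0 suffice.\<close>

definition rotate_form :: "'a::comm_ring_1 tpoly \<Rightarrow> 'a tpoly" where
  "rotate_form F = tsubst F varY varZ varX"

lemma teval_rotate: "comm_ring_hom h \<Longrightarrow> teval h (rotate_form F) x y z = teval h F y z x"
  by (simp add: rotate_form_def teval_tsubst teval_var)

lemma rotate_rotate_rotate: "rotate_form (rotate_form (rotate_form F)) = F"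
proof -
  have "rotate_form F = teval tconst F varY varZ varX" for F :: "'a tpoly"
    by (simp add: rotate_form_def tsubst_eq_teval)
  then have "rotate_form (rotate_form (rotate_form F)) = teval tconst (rotate_form (rotate_form F)) varY varZ varX"
    by simp
  also have "\<dots> = F" by (simp add: teval_rotate[OF tconst_hom] teval_self)
  finally show ?thesis .
qed

lemma rotate_mult: "rotate_form (F * G) = rotate_form F * rotate_form G"
  by (simp add: rotate_form_def tsubst_eq_teval teval_mult[OF tconst_hom])

lemma rotate_dvd: "F dvd G \<Longrightarrow> rotate_form F dvd rotate_form G"
  by (metis dvd_def rotate_mult)

lemma rotate_unit:
  fixes F :: "'a::comm_ring_1 tpoly"
  assumes "F dvd 1"
  shows "rotate_form F dvd 1"
proof -
  have "rotate_form (1 :: 'a tpoly) = 1" by (simp add: rotate_form_def tsubst_eq_teval teval_1[OF tconst_hom])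
  then show ?thesis using rotate_dvd[OF assms] by simp
qed

text \<open>Rotation is multiplicative and has order three, so its square undoes it and
  factorizations can be rotated back.\<close>

lemma irreducible_rotate:
  assumes "irreducible F"
  shows "irreducible (rotate_form F)"
proof (rule irreducibleI)
  have "rotate_form 0 = 0" by (simp add: rotate_form_def tsubst_eq_teval teval_0[OF tconst_hom])
  then show "rotate_form F \<noteq> 0" using assms rotate_rotate_rotate[of F] by (metis irreducible_not_unit not_irreducible_zero)
  have unit: "rotate_form G dvd 1 \<Longrightarrow> G dvd 1" for G :: "'a tpoly"
    using rotate_unit[of "rotate_form (rotate_form G)"] rotate_unit[of "rotate_form G"]
    by (simp add: rotate_rotate_rotate)
  then show "\<not> rotate_form F dvd 1" using assms irreducible_not_unit by blast
  fix a b assume "rotate_form F = a * b"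
  then have "F = rotate_form (rotate_form a) * rotate_form (rotate_form b)"
    using rotate_rotate_rotate[of F] by (simp add: rotate_mult)
  then have "rotate_form (rotate_form a) dvd 1 \<or> rotate_form (rotate_form b) dvd 1"
    by (rule irreducibleD[OF assms])
  then show "a dvd 1 \<or> b dvd 1" using unit by blast
qed

section \<open>Reduction to one axis and the local structure of the curve on it\<close>

context finite_subfield begin

definition perspectivity_invariant_Z :: "'a tpoly \<Rightarrow> bool" where
  "perspectivity_invariant_Z F \<longleftrightarrow> (\<forall>a\<in>Fq. \<forall>b\<in>Fq. \<forall>c\<in>Fq - {0}.
     tsubst F (varX + tconst a * varZ) (varY + tconst b * varZ) (tconst c * varZ) = F)"

lemma perspectivity_invariantI:
  assumes "perspectivity_invariant_Z F" "perspectivity_invariant_Z (rotate_form F)"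
    "perspectivity_invariant_Z (rotate_form (rotate_form F))"
  shows "perspectivity_invariant F"
  unfolding perspectivity_invariant_def
proof (intro ballI conjI)
  fix a b c assume abc: "a \<in> Fq" "b \<in> Fq" "c \<in> Fq - {0}"
  note s = teval_tsubst[OF tconst_hom] teval_simps[OF tconst_hom] teval_rotate[OF tconst_hom]
  show "tsubst F (varX + tconst a * varZ) (varY + tconst b * varZ) (tconst c * varZ) = F"
    using assms(1) abc by (simp add: perspectivity_invariant_Z_def)
  \<comment> \<open>Rotation reverses the roles of the two translation parameters, so
    \<open>a\<close> and \<open>b\<close> are exchanged here.\<close>
  have "tsubst (rotate_form F) (varX + tconst b * varZ) (varY + tconst a * varZ) (tconst c * varZ) = rotate_form F"
    using assms(2) abc by (simp add: perspectivity_invariant_Z_def)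
  from arg_cong[OF this, of "\<lambda>F. teval tconst F varZ varX varY"]
  have "teval tconst F (varX + tconst a * varY) (tconst c * varY) (varZ + tconst b * varY) = teval tconst F varX varY varZ"
    by (simp add: s)
  then show "tsubst F (varX + tconst a * varY) (tconst c * varY) (varZ + tconst b * varY) = F"
    by (simp add: tsubst_eq_teval teval_self)
  have "tsubst (rotate_form (rotate_form F)) (varX + tconst a * varZ) (varY + tconst b * varZ) (tconst c * varZ)
      = rotate_form (rotate_form F)"
    using assms(3) abc by (simp add: perspectivity_invariant_Z_def)
  from arg_cong[OF this, of "\<lambda>F. teval tconst F varY varZ varX"]
  have "teval tconst F (tconst c * varX) (varY + tconst a * varX) (varZ + tconst b * varX) = teval tconst F varX varY varZ"
    by (simp add: s)
  then show "tsubst F (tconst c * varX) (varY + tconst a * varX) (varZ + tconst b * varX) = F"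
    by (simp add: tsubst_eq_teval teval_self)
qed

text \<open>The first claim comes from the product with \<open>moore2\<close>. On \<open>Fq\<close>
  the value is 1: at 0 by inspection, elsewhere as a sum of q + 1 ones. So the points of the curve
  on Z = 0 lie where \<open>moore2\<close> does not vanish.\<close>

lemma dickson2_root:
  assumes "dickson2 q r 1 = (0::'a)"
  shows "r ^ (q ^ 2) = r" "r \<notin> Fq"
proof -
  show "r ^ (q ^ 2) = r" using dickson2_mult_moore2[of r 1] assms by simp
  show "r \<notin> Fq"
  proof
    assume r: "r \<in> Fq"
    show False
    proof (cases "r = 0")
      case True
      then show False using assms by (simp add: dickson2_0_1)
    next
      case False
      have "r ^ (q - 1) * r = r" using r power_minus_mult[OF q_pos, of r] by (simp add: Fq_def)
      then have "r ^ (q - 1) = 1" using False by simp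
      then have "dickson2 q r 1 = of_nat (q + 1)" by (simp add: dickson2_def)
      then show False using assms of_nat_q by simp
    qed
  qed
qed

text \<open>At a point \<open>(r, 1, 0)\<close> of the DGZ curve the local equation is
  \<open>u x ^ q + v z ^ (q - 1)\<close> plus terms of higher weight when \<open>x\<close> has weight \<open>q - 1\<close> and \<open>z\<close> has
  weight \<open>q\<close>. As \<open>q\<close> and \<open>q - 1\<close> are coprime, this Newton polygon does not decompose.
  The substitution \<open>x = s t ^ (q - 1)\<close>, \<open>z = (1 - s) t ^ q\<close> turns the weight into the order in \<open>t\<close>;
  \<open>s = 1\<close> and \<open>s = 0\<close> recover the two axes.\<close>

lemma dgz_unibranch:
  assumes G: "dgz_form = A * B"
    and A0: "teval (\<lambda>c. c) A r 1 0 = 0" and B0: "teval (\<lambda>c. c) B r 1 0 = 0"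
  shows False
proof -
  note id = comm_ring_hom_id
  have "dickson2 q r 1 ^ q = 0"
    using arg_cong[OF G, of "\<lambda>F. teval (\<lambda>c. c) F r 1 0"] A0
    by (simp add: teval_mult[OF id] teval_dgz_form[OF id] dgz_on_Z)
  then have dr: "dickson2 q r 1 = 0" by simp
  note r = dickson2_root[OF dr]
  have l0: "r - r ^ q \<noteq> 0" using r(2) by (auto simp: Fq_def)

  \<comment> \<open>The local equation on the axis Z = 0 is the q-th power of \<open>D\<close>. By
    r^(q^2) = r the product of \<open>D\<close> with the nonvanishing \<open>moore2\<close> is x -
    x^(q^2), so \<open>D\<close> has a simple zero.\<close>
  define D where "D = dickson2 q [:r, 1:] 1"
  have rx: "[:r, 1:] = [:r:] + [:0, 1:]" by simp
  have "[:r, 1:] ^ (q ^ 2) = [:r ^ (q ^ 2):] + [:0, 1:] ^ (q ^ 2)"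
    unfolding power_q_2 rx frobenius_add[OF of_nat_p_poly] by (simp add: const_power)
  then have "D * moore2 q [:r, 1:] 1 = [:0, 1:] - [:0, 1:] ^ (q ^ 2)"
    unfolding D_def dickson2_mult_moore2 by (simp add: r(1))
  also have "\<dots> = [:0, 1:] * (1 - [:0, 1:] ^ (q ^ 2 - 1))"
    using q_pos by (simp add: right_diff_distrib flip: power_Suc)
  finally have Dl: "D * moore2 q [:r, 1:] 1 = [:0, 1:] * (1 - [:0, 1:] ^ (q ^ 2 - 1))" .
  have q21: "q ^ 2 - 1 > 0" using q_ge_2 power_strict_increasing[of 1 2 q] by simp
  have "poly (1 - [:0, 1::'a:] ^ (q ^ 2 - 1)) 0 \<noteq> 0"
    using q21 by (simp add: power_0_left)
  then have o1: "order 0 (1 - [:0, 1::'a:] ^ (q ^ 2 - 1)) = 0" "1 - [:0, 1::'a:] ^ (q ^ 2 - 1) \<noteq> 0"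
    by (rule order_0I, metis poly_0)
  have ox: "order 0 [:0, 1::'a:] = 1" using order_power_n_n[of "0::'a" 1] by simp
  have "poly (moore2 q [:r, 1:] 1) 0 \<noteq> 0" using l0 by (simp add: moore2_def)
  then have o2: "order 0 (moore2 q [:r, 1:] 1) = 0" by (rule order_0I)
  have Dl_nz: "D * moore2 q [:r, 1:] 1 \<noteq> 0" unfolding Dl using o1(2) by simp
  then have D_nz: "D \<noteq> 0" by auto
  have "order 0 (D * moore2 q [:r, 1:] 1) = order 0 D" by (subst order_mult[OF Dl_nz]) (simp add: o2)
  moreover have "order 0 (D * moore2 q [:r, 1:] 1) = 1"
    using order_mult[OF Dl_nz[unfolded Dl], of 0] unfolding Dl ox o1 by (simp only:)
  ultimately have oD: "order 0 D = 1" by simp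
  have "poly D 0 = 0" using oD D_nz by (metis order_0I zero_neq_one)
  then obtain D' where D': "D = [:0, 1:] * D'" using poly_eq_0_iff_dvd[of D 0] by (auto elim: dvdE)

  define a b where "a = teval const1 A [:r, 1:] 1 0" and "b = teval const1 B [:r, 1:] 1 0"
  have ab: "a * b = D ^ q"
    using arg_cong[OF G, of "\<lambda>F. teval const1 F [:r, 1:] 1 0"]
    by (simp add: teval_mult[OF const1_hom] teval_dgz_form[OF const1_hom] dgz_on_Z a_def b_def D_def)
  have ab_nz: "a * b \<noteq> 0" unfolding ab using D_nz by simp
  have sum1: "order 0 a + order 0 b = q"
    using order_mult[OF ab_nz, of 0] order_0_power[OF D_nz, of q] oD by (simp add: ab)

  \<comment> \<open>On the transversal line X = rY the Dickson term vanishes, and the linear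
    coefficient of \<open>V\<close> is a power of r - r^q, so this zero is simple as well.\<close>
  define V where "V = span_poly q [:r:] 1 [:0, 1:]"
  have "dickson2 q [:r:] 1 = 0"
    using comm_ring_hom.hom_dickson2[OF const1_hom, of q r 1] dr by (simp add: pCons_one)
  moreover have "moore2 q [:r:] 1 = [:r - r ^ q:]" by (simp add: moore2_def const_power)
  ultimately have V: "V = [:0, 1:] ^ (q ^ 2) + [:r - r ^ q:] ^ (q - 1) * [:0, 1:]"
    and dgzV: "dgz q [:r:] 1 [:0, 1:] = V ^ (q - 1)"
    using q_pos by (simp_all add: V_def span_poly_def dgz_def)
  have V': "V = [:0, 1:] * ([:0, 1:] ^ (q ^ 2 - 1) + [:r - r ^ q:] ^ (q - 1))"
    unfolding V distrib_left using q_pos by (simp add: mult.commute flip: power_Suc)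
  have "poly ([:0, 1:] ^ (q ^ 2 - 1) + [:r - r ^ q:] ^ (q - 1)) 0 \<noteq> 0"
    using q21 l0 by (simp add: power_0_left const_power)
  then have o3: "order 0 ([:0, 1:] ^ (q ^ 2 - 1) + [:r - r ^ q:] ^ (q - 1)) = 0"
    "[:0, 1:] ^ (q ^ 2 - 1) + [:r - r ^ q:] ^ (q - 1) \<noteq> 0"
    by (rule order_0I, metis poly_0)
  have V_nz: "V \<noteq> 0" unfolding V' using o3(2) by simp
  have oV: "order 0 V = 1"
    using order_mult[OF V_nz[unfolded V'], of 0] unfolding V' ox o3 by (simp only:)
  define a' b' where "a' = teval const1 A [:r:] 1 [:0, 1:]" and "b' = teval const1 B [:r:] 1 [:0, 1:]"
  have ab': "a' * b' = V ^ (q - 1)"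
    using arg_cong[OF G, of "\<lambda>F. teval const1 F [:r:] 1 [:0, 1:]"]
    by (simp add: teval_mult[OF const1_hom] teval_dgz_form[OF const1_hom] dgzV a'_def b'_def)
  have ab'_nz: "a' * b' \<noteq> 0" unfolding ab' using V_nz by simp
  have sum2: "order 0 a' + order 0 b' = q - 1"
    using order_mult[OF ab'_nz, of 0] order_0_power[OF V_nz, of "q - 1"] oV by (simp add: ab')

  \<comment> \<open>The outer variable is t, whose order at 0 measures the weight; the coefficients
    are polynomials in s.\<close>
  define w x z where "w = monom [:0, 1::'a:] (q - 1)" and "x = const2 r + w"
    and "z = monom (1 - [:0, 1::'a:]) q"
  define At Bt where "At = teval const2 A x 1 z" and "Bt = teval const2 B x 1 z"
  \<comment> \<open>\<open>?ev\<close> specializes s and keeps t, so a power of t that divides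
    before specialization still divides afterwards.\<close>
  let ?ev = "\<lambda>s. map_poly (\<lambda>f::'a poly. poly f s)"
  have ev: "comm_ring_hom (?ev s)" for s
    by (rule map_poly_comm_ring_hom) (rule poly_hom.comm_ring_hom_axioms)
  have ev_const: "?ev s [:g:] = [:poly g s:]" for s g
    by (intro poly_eqI) (simp add: coeff_map_poly coeff_pCons split: nat.split)
  have ev_monom: "?ev s (monom g k) = monom (poly g s) k" for s g k
    by (intro poly_eqI) (simp add: coeff_map_poly)
  have ev_add: "?ev s (f + g) = ?ev s f + ?ev s g" and ev_mult: "?ev s (f * g) = ?ev s f * ?ev s g"
    and ev_1: "?ev s 1 = 1" for s f g
  proof -
    interpret e: comm_ring_hom "?ev s" by (rule ev)
    show "?ev s (f + g) = ?ev s f + ?ev s g" "?ev s (f * g) = ?ev s f * ?ev s g" "?ev s 1 = 1"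
      by (rule e.hom_add e.hom_mult e.hom_one)+
  qed
  have axis0: "?ev 0 (teval const2 F x 1 z) = pcompose (teval const1 F [:r:] 1 [:0, 1:]) (monom 1 q)"
    and axis1: "?ev 1 (teval const2 F x 1 z) = pcompose (teval const1 F [:r, 1:] 1 0) (monom 1 (q - 1))" for F
    unfolding hom_teval[OF const2_hom ev] hom_teval[OF const1_hom pcompose_hom.comm_ring_hom_axioms]
    by (simp_all add: x_def w_def z_def ev_add ev_const ev_monom ev_1 pcompose_pCons pcompose_1)
  have pos: "q > 0" "q - 1 > 0" using q_ge_2 by simp_all
  have a_nz: "a \<noteq> 0" "b \<noteq> 0" "a' \<noteq> 0" "b' \<noteq> 0" using ab_nz ab'_nz by auto
  have bounds: "n \<le> q * order 0 (teval const1 F [:r:] 1 [:0, 1:])"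
      "n \<le> (q - 1) * order 0 (teval const1 F [:r, 1:] 1 0)"
    if "monom 1 n dvd teval const2 F x 1 z" "teval const1 F [:r:] 1 [:0, 1:] \<noteq> 0" "teval const1 F [:r, 1:] 1 0 \<noteq> 0" for n F
  proof -
    from that(1) obtain K where K: "teval const2 F x 1 z = monom 1 n * K" by (rule dvdE)
    have "?ev s (teval const2 F x 1 z) = monom 1 n * ?ev s K" for s
      unfolding K ev_mult by (simp add: ev_monom)
    then have dvd: "monom 1 n dvd ?ev s (teval const2 F x 1 z)" for s by simp
    show "n \<le> q * order 0 (teval const1 F [:r:] 1 [:0, 1:])"
      using dvd[of 0] le_order_0_if_monom_dvd[of "?ev 0 (teval const2 F x 1 z)" n]
        order_0_pcompose_monom[OF that(2) pos(1)] by (simp add: axis0)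
    show "n \<le> (q - 1) * order 0 (teval const1 F [:r, 1:] 1 0)"
      using dvd[of 1] le_order_0_if_monom_dvd[of "?ev 1 (teval const2 F x 1 z)" n]
        order_0_pcompose_monom[OF that(3) pos(2)] by (simp add: axis1)
  qed
  have At_nz: "At \<noteq> 0" "Bt \<noteq> 0"
  proof -
    have "?ev 0 At \<noteq> 0" "?ev 0 Bt \<noteq> 0"
      unfolding At_def Bt_def axis0 using order_0_pcompose_monom(2)[OF _ pos(1)] a_nz by (simp_all add: a'_def b'_def)
    then show "At \<noteq> 0" "Bt \<noteq> 0" by auto
  qed
  have "monom 1 (q * (q - 1)) dvd At * Bt"
  proof -
    \<comment> \<open>Substituting w into \<open>D\<close> gives \<open>dickson2 q x 1\<close>; the
      zero of \<open>D\<close> at 0 turns into a factor w, hence into t^(q - 1).\<close>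
    let ?s = "\<lambda>f. poly (map_poly const2 f) w"
    have s: "comm_ring_hom ?s"
      by (rule comm_ring_hom_comp[OF poly_hom.comm_ring_hom_axioms map_poly_comm_ring_hom[OF const2_hom]])
    have s_lin: "?s [:c, 1:] = const2 c + w" for c
    proof -
      have "map_poly const2 [:c, 1:] = [:const2 c, 1:]"
        by (intro poly_eqI) (simp add: coeff_map_poly coeff_pCons pCons_one split: nat.split)
      then show ?thesis by (simp add: pCons_one)
    qed
    interpret s: comm_ring_hom ?s by (rule s)
    have "dickson2 q x 1 = ?s D"
      unfolding D_def s.hom_dickson2 s_lin x_def s.hom_one ..
    also have "\<dots> = w * ?s D'"
      unfolding D' s.hom_mult s_lin by simp
    finally have "w dvd dickson2 q x 1" by simp
    moreover have "monom 1 (q - 1) dvd w"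
      unfolding w_def by (rule dvdI[of _ _ "[:[:0, 1:]:]"]) (simp add: smult_monom mult.commute)
    ultimately have "monom 1 (q - 1) ^ q dvd dickson2 q x 1 ^ q"
      by (intro dvd_power_same) (rule dvd_trans)
    moreover have "monom 1 q ^ (q - 1) dvd span_poly q x 1 z ^ (q - 1)"
    proof (intro dvd_power_same)
      have "monom 1 q dvd z"
        unfolding z_def by (rule dvdI[of _ _ "[:1 - [:0, 1:]:]"]) (simp add: smult_monom mult.commute)
      also have "z dvd span_poly q x 1 z"
        unfolding span_poly_def using q_pos by (intro dvd_add dvd_diff dvd_mult) (auto intro: dvd_power)
      finally show "monom 1 q dvd span_poly q x 1 z" .
    qed
    ultimately have "monom 1 (q * (q - 1)) dvd dgz q x 1 z"
      unfolding dgz_def by (intro dvd_add) (simp_all add: monom_power mult.commute)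
    also have "dgz q x 1 z = At * Bt"
      using arg_cong[OF G, of "\<lambda>F. teval const2 F x 1 z"]
      by (simp add: teval_mult[OF const2_hom] teval_dgz_form[OF const2_hom] At_def Bt_def)
    finally show ?thesis .
  qed
  \<comment> \<open>The total order is at least q (q - 1), while each axis bounds it by exactly that
    amount. Hence all bounds are equalities, and coprimality of q and q - 1 forces q to divide
    \<open>order 0 a\<close>, which lies strictly between 0 and q.\<close>
  then have "q * (q - 1) \<le> order 0 At + order 0 Bt"
    using le_order_0_if_monom_dvd[of "At * Bt"] At_nz by (simp add: order_mult)
  moreover have "order 0 At \<le> q * order 0 a'" "order 0 At \<le> (q - 1) * order 0 a"
    "order 0 Bt \<le> q * order 0 b'" "order 0 Bt \<le> (q - 1) * order 0 b"
    using a_nz bounds[OF monom_order_0_dvd[of "teval const2 A x 1 z"]]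
      bounds[OF monom_order_0_dvd[of "teval const2 B x 1 z"]]
    unfolding At_def Bt_def a_def a'_def b_def b'_def by blast+
  moreover have "q * order 0 a' + q * order 0 b' = q * (q - 1)"
    "(q - 1) * order 0 a + (q - 1) * order 0 b = q * (q - 1)"
    unfolding add_mult_distrib2[symmetric] sum1 sum2 by simp_all
  ultimately have "q * order 0 a' = (q - 1) * order 0 a" by linarith
  then have "q dvd (q - 1) * order 0 a" by (metis dvd_triv_left)
  moreover have "coprime q (q - 1)" using q_pos coprime_Suc_left_nat[of "q - 1"] by simp
  ultimately have "q dvd order 0 a" using coprime_dvd_mult_right_iff by blast
  moreover have "order 0 a > 0" "order 0 b > 0"
  proof -
    have hp: "poly (teval const1 F [:r, 1:] 1 0) 0 = teval (\<lambda>c. c) F r 1 0" for F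
      using hom_teval[OF const1_hom poly_hom.comm_ring_hom_axioms, of F "[:r, 1:]" 1 0 0] by simp
    show "order 0 a > 0" "order 0 b > 0"
      using a_nz A0 B0 by (simp_all add: order_gt_0_iff a_def b_def hp)
  qed
  ultimately show False using sum1 by (auto dest: dvd_imp_le)
qed

end

section \<open>Explicit matrices in GL(3,q) and the invariance of irreducible factors\<close>

lemma GL3q_vector:
  fixes A :: "'a::field ^ 3 ^ 3"
  assumes "A = vector [vector [a1, b1, c1], vector [a2, b2, c2], vector [a3, b3, c3]]"
    and "{a1, b1, c1, a2, b2, c2, a3, b3, c3} \<subseteq> {a. a ^ q = a}"
    and "a1 * b2 * c3 + b1 * c2 * a3 + c1 * a2 * b3 - a1 * c2 * b3 - b1 * a2 * c3 - c1 * b2 * a3 \<noteq> 0"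
  shows "A \<in> GL3q q"
    and "transform F A = tsubst F (tconst a1 * varX + tconst b1 * varY + tconst c1 * varZ)
      (tconst a2 * varX + tconst b2 * varY + tconst c2 * varZ)
      (tconst a3 * varX + tconst b3 * varY + tconst c3 * varZ)"
  using assms(2,3) unfolding assms(1)
  by (auto simp: GL3q_def det_3 vector_3 forall_3 transform_def lin_form_def)

lemma irreducible_form_degree:
  fixes F :: "'a::field tpoly"
  assumes "form_of_degree F d" "irreducible F"
  shows "d \<noteq> 0"
proof
  assume "d = 0"
  then have "F dvd 1" using assms(1) by (simp add: tpoly_unit_iff form_0_iff_tconst)
  then show False using irreducible_not_unit[OF assms(2)] by contradiction
qed

context finite_subfield begin

lemma perspectivity_transform:
  assumes "a \<in> Fq" "b \<in> Fq" "c \<in> Fq - {0}"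
  obtains A where "A \<in> GL3q q"
    "\<And>F. transform F A = tsubst F (varX + tconst a * varZ) (varY + tconst b * varZ) (tconst c * varZ)"
proof -
  let ?A = "vector [vector [1, 0, a], vector [0, 1, b], vector [0, 0, c]] :: 'a ^ 3 ^ 3"
  have *: "{1, 0, a, 0, 1, b, 0, 0, c} \<subseteq> {a. a ^ q = a}"
    using assms Fq_0 Fq_1 by (auto simp: Fq_def)
  show thesis
    by (rule that[of ?A]; insert GL3q_vector[OF refl *] assms(3))
       (simp_all add: tconst_0 tconst_1)
qed

lemma rotate_transform:
  obtains A where "A \<in> GL3q q" "\<And>F. transform F A = rotate_form (F :: 'a tpoly)"
proof -
  let ?A = "vector [vector [0, 1, 0], vector [0, 0, 1], vector [1, 0, 0]] :: 'a ^ 3 ^ 3"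
  have *: "{0, 1, 0, 0, 0, 1, 1, 0, 0} \<subseteq> {a :: 'a. a ^ q = a}"
    using Fq_0 Fq_1 by (auto simp: Fq_def)
  show thesis
    by (rule that[of ?A]; insert GL3q_vector[OF refl *])
       (simp_all add: tconst_0 tconst_1 rotate_form_def)
qed

lemma rotate_dgz_form: "rotate_form dgz_form = dgz_form"
  using rotate_transform dgz_form_transform by metis

lemma restrict_perspectivity:
  "teval tconst (tsubst F (varX + tconst a * varZ) (varY + tconst b * varZ) (tconst c * varZ)) varX varY 0 =
     teval tconst F varX varY 0"
  by (simp add: teval_tsubst[OF tconst_hom] teval_simps[OF tconst_hom])

text \<open>A perspectivity \<sigma> preserves the DGZ form and fixes the axis, where A has a zero.
  If A divided \<sigma> B, then both \<sigma> A and \<sigma> B would vanish there, against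
  \<open>dgz_unibranch\<close>. So A divides \<sigma> A, and restriction to the axis shows that the
  cofactor is 1.\<close>

lemma irreducible_factor_invariant_Z:
  assumes irr: "irreducible A" and dvd: "A dvd dgz_form"
  shows "perspectivity_invariant_Z A"
  unfolding perspectivity_invariant_Z_def
proof (intro ballI)
  fix a b c assume abc: "a \<in> Fq" "b \<in> Fq" "c \<in> Fq - {0}"
  note id = comm_ring_hom_id
  define \<sigma> where "\<sigma> F = tsubst F (varX + tconst a * varZ) (varY + tconst b * varZ) (tconst c * varZ)" for F :: "'a tpoly"
  have \<sigma>_mult: "\<sigma> (F * G) = \<sigma> F * \<sigma> G" for F G
    by (simp add: \<sigma>_def tsubst_eq_teval teval_mult[OF tconst_hom])
  have \<sigma>_eval: "teval (\<lambda>c. c) (\<sigma> F) x y 0 = teval (\<lambda>c. c) F x y 0" for F x y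
    by (simp add: \<sigma>_def teval_tsubst[OF id] teval_simps[OF id])
  obtain B where B: "dgz_form = A * B" using dvd by (rule dvdE)
  obtain T where "T \<in> GL3q q" "\<And>F. transform F T = \<sigma> F"
    unfolding \<sigma>_def using perspectivity_transform[OF abc] by metis
  then have \<sigma>_dgz: "dgz_form = \<sigma> A * \<sigma> B"
    using dgz_form_transform[of T] by (simp only: \<sigma>_mult[symmetric] B[symmetric])
  obtain m where m: "form_of_degree A m"
    using form_dgz_form form_mult_form unfolding B by blast
  have "m \<noteq> 0"
    using irreducible_form_degree[OF m irr] .
  \<comment> \<open>The DGZ form takes the value 1 at (1, 0, 0), so the restriction of A to Z = 0
    keeps its full positive degree and has a root r.\<close>
  have "teval (\<lambda>c. c) A 1 0 0 * teval (\<lambda>c. c) B 1 0 0 = 1"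
    using arg_cong[OF B, of "\<lambda>F. teval (\<lambda>c. c) F 1 0 0"]
    by (simp add: teval_mult[OF id] teval_dgz_form[OF id] dgz_on_Z dickson2_1_0)
  then have A100: "teval (\<lambda>c. c) A 1 0 0 \<noteq> 0" by auto
  then have "coeff (teval const1 A [:0, 1:] 1 0) m \<noteq> 0"
    using coeff_X10[OF m, of m] teval_unit_vectors(1)[OF m] by simp
  then have "degree (teval const1 A [:0, 1:] 1 0) > 0"
    using \<open>m \<noteq> 0\<close> le_degree by fastforce
  then obtain r where "poly (teval const1 A [:0, 1:] 1 0) r = 0"
    using alg by (auto simp: alg_closed_def)
  then have r: "teval (\<lambda>c. c) A r 1 0 = 0"
    using hom_teval[OF const1_hom poly_hom.comm_ring_hom_axioms, of A "[:0, 1:]" 1 0 r] by simp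
  have "A dvd \<sigma> A * \<sigma> B" using dvd \<sigma>_dgz by simp
  moreover have "\<not> A dvd \<sigma> B"
  proof
    assume "A dvd \<sigma> B"
    then obtain C where "\<sigma> B = A * C" by (rule dvdE)
    then have "dgz_form = \<sigma> A * (A * C)" using \<sigma>_dgz by simp
    then show False
      by (rule dgz_unibranch[where r = r]) (simp_all add: \<sigma>_eval r teval_mult[OF id])
  qed
  ultimately have "A dvd \<sigma> A" using tpoly_irreducible_dvd_mult[OF irr] by blast
  then obtain C where C: "\<sigma> A = A * C" by (rule dvdE)
  have "dgz_form = A * (C * \<sigma> B)" using \<sigma>_dgz by (simp add: C mult.assoc)
  then obtain k where "form_of_degree (C * \<sigma> B) k"
    using form_dgz_form form_mult_form by metis
  then obtain e where e: "form_of_degree C e" using form_mult_form by blast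
  let ?A = "teval tconst A varX varY 0"
  have "?A \<noteq> 0"
  proof
    assume "?A = 0"
    then have "teval (\<lambda>c. c) ?A 1 0 0 = 0" by (simp add: teval_0[OF id])
    then show False
      using A100 by (simp add: hom_teval[OF tconst_hom teval_hom[OF id]] teval_simps[OF id])
  qed
  moreover have "teval tconst C varX varY 0 * ?A = 1 * ?A"
  proof -
    have "?A = teval tconst (\<sigma> A) varX varY 0" unfolding \<sigma>_def by (rule restrict_perspectivity[symmetric])
    also have "\<dots> = ?A * teval tconst C varX varY 0" unfolding C by (rule teval_mult[OF tconst_hom])
    finally show ?thesis by (simp only: mult_1_left mult.commute)
  qed
  ultimately have "teval tconst C varX varY 0 = 1" by (metis tpoly_mult_cancel)
  then have "teval (\<lambda>c. c) (teval tconst C varX varY 0) 0 0 0 = 1" by (simp add: teval_1[OF id])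
  then have C000: "teval (\<lambda>c. c) C 0 0 0 = 1"
    by (simp add: hom_teval[OF tconst_hom teval_hom[OF id]] teval_simps[OF id])
  \<comment> \<open>A form with a nonzero value at the origin has degree 0.\<close>
  have "e = 0"
    using teval_homogeneous[OF id e, of 0 0 0 0] C000 by (cases e) simp_all
  then obtain k where "C = tconst k" using e form_0_iff_tconst by blast
  then have "C = 1" using C000 by (simp add: teval_tconst[OF id] tconst_1)
  then show "tsubst A (varX + tconst a * varZ) (varY + tconst b * varZ) (tconst c * varZ) = A"
    using C by (simp add: \<sigma>_def)
qed

lemma irreducible_factor_invariant:
  assumes irr: "irreducible A" and dvd: "A dvd dgz_form"
  shows "perspectivity_invariant A"
proof -
  have "rotate_form A dvd dgz_form" "rotate_form (rotate_form A) dvd dgz_form"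
    using rotate_dvd[OF dvd] rotate_dvd[OF rotate_dvd[OF dvd]] by (simp_all only: rotate_dgz_form)
  then show ?thesis
    using assms by (intro perspectivity_invariantI irreducible_factor_invariant_Z irreducible_rotate)
qed

lemma degree_bounds: "q ^ 3 - q ^ 2 < q ^ 3 - q" "0 < q ^ 3 - q ^ 2"
  using q_ge_2 power_strict_increasing[of 1 2 q] power_strict_increasing[of 1 3 q]
    power_strict_increasing[of 2 3 q]
  by (auto intro!: diff_less_mono2)

text \<open>A divisor of least positive degree is irreducible, therefore invariant under
  perspectivities, and the degree result leaves only the full degree.\<close>

proposition irreducible_dgz_form: "irreducible dgz_form"
proof -
  let ?d = "q ^ 3 - q ^ 2"
  let ?P = "\<lambda>m. m > 0 \<and> (\<exists>A. form_of_degree A m \<and> A dvd dgz_form)"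
  define m where "m = (LEAST m. ?P m)"
  have Pd: "?P ?d" using degree_bounds(2) form_dgz_form by (intro conjI exI[of _ dgz_form]) simp_all
  have Pm: "?P m" unfolding m_def by (rule LeastI[of ?P ?d, OF Pd])
  then have m_pos: "m > 0" by (rule conjunct1)
  have least: "k = 0 \<or> m \<le> k" if "form_of_degree A k" "A dvd dgz_form" for A k
  proof (cases "k = 0")
    case False
    then have "?P k" using that by (intro conjI exI[of _ A]) simp_all
    from Least_le[of ?P k, OF this] show ?thesis by (simp only: m_def simp_thms)
  qed simp
  \<comment> \<open>Shown for every divisor of degree m, so that it can finally be applied to the
    DGZ form itself.\<close>
  have irr: "irreducible A" if A: "form_of_degree A m" "A dvd dgz_form" for A
  proof (rule irreducibleI)
    show "A \<noteq> 0" using A(1) by (rule form_nonzero)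
    show "\<not> A dvd 1"
    proof
      assume "A dvd 1"
      then have "form_of_degree A 0" by (simp add: tpoly_unit_iff form_0_iff_tconst)
      from form_unique_degree[OF A(1) this] show False using m_pos by simp
    qed
    fix B C assume BC: "A = B * C"
    then obtain b c where bc: "form_of_degree B b" "form_of_degree C c" "b + c = m"
      using form_mult_form[OF A(1)[unfolded BC]] by metis
    have "B dvd dgz_form" "C dvd dgz_form"
      using dvd_mult_left[OF A(2)[unfolded BC]] dvd_mult_right[OF A(2)[unfolded BC]] .
    then have "b = 0 \<or> m \<le> b" "c = 0 \<or> m \<le> c" using least bc(1,2) by simp_all
    then have "b = 0 \<or> c = 0" using bc(3) m_pos by linarith
    then have "form_of_degree B 0 \<or> form_of_degree C 0" using bc(1,2) by auto
    then show "B dvd 1 \<or> C dvd 1" by (simp only: tpoly_unit_iff form_0_iff_tconst)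
  qed
  from Pm obtain A where A: "form_of_degree A m" "A dvd dgz_form" by (elim conjE exE)
  have inv: "perspectivity_invariant A"
    by (rule irreducible_factor_invariant[OF irr[OF A] A(2)])
  have "m \<le> ?d" using least[OF form_dgz_form dvd_refl] degree_bounds(2) by linarith
  then have "m < q ^ 3 - q" using degree_bounds by linarith
  note deg = invariant_form_degree[OF inv A(1) this]
  have "m = ?d"
    using deg no_invariant_form_divisible_by_Z[OF inv A(1) \<open>m \<le> ?d\<close>] m_pos by (metis less_irrefl)
  then show ?thesis using irr[OF _ dvd_refl] form_dgz_form by simp
qed

section \<open>From PGL(3,q)-invariance to the DGZ form and back\<close>

lemma PGL3q_invariant_dgz_multiple:
  assumes "t \<noteq> 0"
  shows "PGL3q_invariant q (tconst t * dgz_form)"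
  unfolding PGL3q_invariant_def
proof
  fix A :: "'a ^ 3 ^ 3" assume "A \<in> GL3q q"
  then have "transform (tconst t * dgz_form) A = tconst 1 * (tconst t * dgz_form)"
    using dgz_form_transform by (simp add: transform_def tsubst_eq_teval teval_simps[OF tconst_hom] tconst_1)
  then show "\<exists>c. c \<noteq> 0 \<and> transform (tconst t * dgz_form) A = tconst c * (tconst t * dgz_form)"
    by (intro exI[of _ 1]) simp
qed

lemma form_tconst_mult:
  assumes "(t::'a) \<noteq> 0" "form_of_degree F d"
  shows "form_of_degree (tconst t * F) d"
proof -
  have "form_of_degree (tconst t) 0" using assms(1) by (auto simp: form_0_iff_tconst)
  from form_mult[OF this assms(2)] show ?thesis by simp
qed

lemma irreducible_tconst_mult:
  assumes "(t::'a) \<noteq> 0" "irreducible F"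
  shows "irreducible (tconst t * F)"
proof (rule irreducibleI)
  have inv: "tconst (inverse t) * (tconst t * G) = G" for G
    by (simp only: mult.assoc[symmetric] tconst_mult[symmetric] left_inverse[OF assms(1)] tconst_1 mult_1_left)
  show "tconst t * F \<noteq> 0"
    using assms by (auto simp: tpoly_mult_eq_0 tconst_eq_0_iff)
  show "\<not> tconst t * F dvd 1"
    using assms(2) by (meson dvd_mult_right irreducible_not_unit)
  fix a b assume "tconst t * F = a * b"
  then have "tconst (inverse t) * (tconst t * F) = tconst (inverse t) * (a * b)" by (rule arg_cong)
  then have "F = (tconst (inverse t) * a) * b" by (simp only: inv mult.assoc)
  then have "tconst (inverse t) * a dvd 1 \<or> b dvd 1" by (rule irreducibleD[OF assms(2)])
  then show "a dvd 1 \<or> b dvd 1" by (meson dvd_mult_right)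
qed

text \<open>If Z divided the irreducible form F, then F would be a multiple of Z, which rotation
  turns into X. So F is nonzero on Z = 0, where perspectivities act trivially, and their scalar
  factor is 1. Rotation changes F only by a scalar, which carries this over to the other two
  axes.\<close>

lemma PGL_invariant_imp_perspectivity_invariant:
  fixes F :: "'a tpoly"
  assumes form: "form_of_degree F d" and irr: "irreducible F" and inv: "PGL3q_invariant q F"
  shows "perspectivity_invariant F" "\<not> varZ dvd F"
proof -
  note id = comm_ring_hom_id
  obtain T where "T \<in> GL3q q" "transform F T = rotate_form F" using rotate_transform by metis
  then obtain k where k: "k \<noteq> 0" "rotate_form F = tconst k * F"
    using inv by (auto simp: PGL3q_invariant_def)
  show nZ: "\<not> varZ dvd F"
  proof
    assume "varZ dvd F"
    then obtain H where H: "F = varZ * H" by (rule dvdE)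
    have "\<not> varZ dvd (1 :: 'a tpoly)"
      unfolding varZ_dvd_iff by (metis lookup_single_eq single_one zero_prod_def zero_neq_one)
    then have "H dvd 1" using irr H irreducibleD by blast
    then obtain c where c: "c \<noteq> 0" "H = tconst c" by (auto simp: tpoly_unit_iff)
    have "teval (\<lambda>c. c) (rotate_form F) 1 0 0 = c"
      by (simp add: teval_rotate[OF id] H c(2) teval_simps[OF id])
    moreover have "teval (\<lambda>c. c) (tconst k * F) 1 0 0 = 0"
      by (simp add: H c(2) teval_simps[OF id])
    ultimately show False using k(2) c(1) by simp
  qed
  have "perspectivity_invariant_Z F"
    unfolding perspectivity_invariant_Z_def
  proof (intro ballI)
    fix a b c assume abc: "a \<in> Fq" "b \<in> Fq" "c \<in> Fq - {0}"
    let ?s = "tsubst F (varX + tconst a * varZ) (varY + tconst b * varZ) (tconst c * varZ)"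
    obtain T where "T \<in> GL3q q" "transform F T = ?s" using perspectivity_transform[OF abc] by metis
    then obtain l where l: "?s = tconst l * F" using inv unfolding PGL3q_invariant_def by metis
    let ?F = "teval tconst F varX varY 0"
    have "tconst l * ?F = 1 * ?F"
      using arg_cong[OF l, of "\<lambda>F. teval tconst F varX varY 0"]
      by (simp add: restrict_perspectivity teval_simps[OF tconst_hom])
    moreover have "?F \<noteq> 0"
    proof
      assume "?F = 0"
      then have "teval const1 ?F [:0, 1:] 1 0 = 0" by (simp add: teval_0[OF const1_hom])
      then have "teval const1 F [:0, 1:] 1 0 = 0"
        by (simp add: hom_teval[OF tconst_hom teval_hom[OF const1_hom]] teval_simps[OF const1_hom])
      then show False using varZ_dvd_if_X10_eq_0[OF form] nZ by blast
    qed
    ultimately have "tconst l = 1" by (metis tpoly_mult_cancel)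
    then show "?s = F" using l by simp
  qed
  moreover have "perspectivity_invariant_Z (tconst k * H)" if "perspectivity_invariant_Z H" for k H
    using that by (simp add: perspectivity_invariant_Z_def tsubst_eq_teval teval_simps[OF tconst_hom])
  moreover have "rotate_form (rotate_form F) = tconst k * (tconst k * F)"
  proof -
    have "rotate_form (tconst k) = tconst k"
      by (simp add: rotate_form_def tsubst_eq_teval teval_tconst[OF tconst_hom])
    then show ?thesis by (simp add: k(2) rotate_mult)
  qed
  ultimately show "perspectivity_invariant F"
    using k(2) by (intro perspectivity_invariantI) simp_all
qed

proposition PGL_invariant_imp_DGZ:
  fixes F :: "'a tpoly"
  assumes form: "form_of_degree F d" and d: "d < q ^ 3 - q" and irr: "irreducible F"
    and inv: "PGL3q_invariant q F"
  shows "is_DGZ q F"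
proof -
  note F = PGL_invariant_imp_perspectivity_invariant[OF form irr inv]
  have "d \<noteq> 0"
    using irreducible_form_degree[OF form irr] .
  then have "d = q ^ 3 - q ^ 2"
    using invariant_form_degree[OF F(1) form d] F(2) by blast
  \<comment> \<open>The DGZ form is invariant as an irreducible divisor of itself, so it can serve
    as the comparison form.\<close>
  then have "\<exists>t. t \<noteq> 0 \<and> F = tconst t * dgz_form"
    using invariant_form_unique[OF F(1) _ irreducible_factor_invariant[OF irreducible_dgz_form dvd_refl] form_dgz_form]
      form by blast
  then show ?thesis by (simp add: is_DGZ_iff)
qed

proposition DGZ_irreducible_PGL_invariant:
  fixes F :: "'a tpoly"
  assumes "is_DGZ q F"
  shows "form_of_degree F (q ^ 3 - q ^ 2)" "irreducible F" "PGL3q_invariant q F"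
proof -
  obtain t where t: "t \<noteq> 0" "F = tconst t * dgz_form" using assms by (auto simp: is_DGZ_iff)
  show "form_of_degree F (q ^ 3 - q ^ 2)" "irreducible F" "PGL3q_invariant q F"
    unfolding t(2) using t(1)
    by (rule form_tconst_mult[OF _ form_dgz_form] irreducible_tconst_mult[OF _ irreducible_dgz_form]
        PGL3q_invariant_dgz_multiple)+
qed

end

text \<open>Exactness of the quotient makes \<open>is_DGZ\<close> satisfiable, and its solutions
  differ only by nonzero scalars, so the equivalence describes exactly one curve.\<close>

theorem mainTheorem6:
  fixes p n q :: nat
  assumes "prime p" and "n \<ge> 1" and "q = p ^ n"
    and "of_nat p = (0::'a::field)"
    and "alg_closed TYPE('a)"
    and "algebraic_over_prime_field TYPE('a)"
  shows "(\<exists>G::'a tpoly. G * moore q (q^2) = moore q (q^3))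
    \<and> (\<forall>F::'a tpoly.
         ((\<exists>d. form_of_degree F d \<and> d < q^3 - q) \<and> irreducible F \<and> PGL3q_invariant q F)
         \<longleftrightarrow> is_DGZ q F)"
proof -
  interpret finite_subfield p n q "TYPE('a)"
    using assms by unfold_locales
  show ?thesis
    using dgz_form_mult_moore PGL_invariant_imp_DGZ DGZ_irreducible_PGL_invariant degree_bounds(1)
    by blast
qed

end
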